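(* The space $\mathcal M_{\mathcal G,\Gamma}$ of all $\Gamma$-mixing actions of $\mathcal G$ is a complete separable metric space with respect to the metric $$\mathrm m_{\mathcal G,\Gamma}(T,S)=\sum_i 2^{-i}\sup_{g\in K_i}\mathrm d(T^g,S^g)+\sup_{g\in\Gamma}\mathrm a(T^g,S^g).$$
   Context: $(X,\Sigma,\mu)$ is a separable Lebesgue space with a non-atomic probability measure $\mu$. $\mathcal A$ is the group of invertible measure-preserving transformations of $X$, two transformations being identified if they agree outside a null set. Fix a countable family $\{A_i\}_{i\in\mathbb N}\subset\Sigma$ that generates $\Sigma$ and is dense in $\Sigma$ (for every $A\in\Sigma$ and $\varepsilon>0$ there is $i$ with $\mu(A_i\triangle A)<\varepsilon$). For $T,S\in\mathcal A$ put $\mathrm d(T,S)=\sum_{i}2^{-i}\big(\mu(TA_i\triangle SA_i)+\mu(T^{-1}A_i\triangle S^{-1}A_i)\big)$ and $\mathrm a(T,S)=\sum_{i,j}2^{-(i+j)}|\mu(TA_i\cap A_j)-\mu(SA_i\cap A_j)|$. $\mathcal G$ is a Hausdorff locally compact group with a countable neighborhood base, with identity $e$. Fix an at most countable family $\{K_i\}$ of compact subsets of $\mathcal G$ with nonempty interiors whose union contains a set generating $\mathcal G$. An action of $\mathcal G$ is a family $T=\{T^g\}_{g\in\mathcal G}\subset\mathcal A$ with $T^gT^h=T^{gh}$ for all $g,h\in\mathcal G$ and such that $g\mapsto\mu(T^gA\cap B)$ is continuous on $\mathcal G$ for all $A,B\in\Sigma$. Let $\Gamma\subset\mathcal G$ be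 an unbounded subset (not contained in any compact set). An action $T$ is $\Gamma$-mixing if for all $A,B\in\Sigma$ and $\varepsilon>0$ there is a compact $C\subset\mathcal G$ with $|\mu(T^gA\cap B)-\mu(A)\mu(B)|<\varepsilon$ for all $g\in\Gamma\setminus C$. $\mathcal M_{\mathcal G,\Gamma}$ is the set of all $\Gamma$-mixing actions of $\mathcal G$. *)

theory Defs
  imports "HOL-Probability.Probability"
begin

definition nonatomic_lebesgue_space :: "'a measure \<Rightarrow> bool" where
  "nonatomic_lebesgue_space M \<longleftrightarrow> prob_space M \<and>
     (\<exists>N N' f. N \<in> null_sets M \<and> N' \<in> null_sets (lebesgue_on {0..1::real}) \<and>
        bij_betw f (space M - N) ({0..1} - N') \<and>
        (\<forall>A. A \<subseteq> space M \<longrightarrow> (A \<in> sets M \<longleftrightarrow> f ` (A - N) \<in> sets (lebesgue_on {0..1}))) \<and>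
        (\<forall>A \<in> sets M. emeasure M A = emeasure (lebesgue_on {0..1}) (f ` (A - N))))"

definition generating_dense_family :: "'a measure \<Rightarrow> (nat \<Rightarrow> 'a set) \<Rightarrow> bool" where
  "generating_dense_family M A \<longleftrightarrow> (\<forall>i. A i \<in> sets M) \<and>
     (\<forall>B \<in> sets M. \<exists>C \<in> sigma_sets (space M) (range A). B - C \<union> (C - B) \<in> null_sets M) \<and>
     (\<forall>B \<in> sets M. \<forall>\<epsilon>>0. \<exists>i. measure M (B - A i \<union> (A i - B)) < \<epsilon>)"

definition measure_preserving_map :: "'a measure \<Rightarrow> ('a \<Rightarrow> 'a) \<Rightarrow> bool" where
  "measure_preserving_map M T \<longleftrightarrow> T \<in> measurable M M \<and>
     (\<forall>B \<in> sets M. emeasure M (T -` B \<inter> space M) = emeasure M B)"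

text \<open>Membership in the group \<open>\<A>\<close> (elements are identified modulo null sets).\<close>
definition invertible_mpt :: "'a measure \<Rightarrow> ('a \<Rightarrow> 'a) \<Rightarrow> bool" where
  "invertible_mpt M T \<longleftrightarrow> measure_preserving_map M T \<and>
     (\<exists>S. measure_preserving_map M S \<and> (AE x in M. S (T x) = x) \<and> (AE x in M. T (S x) = x))"

definition mpt_inv :: "'a measure \<Rightarrow> ('a \<Rightarrow> 'a) \<Rightarrow> 'a \<Rightarrow> 'a" where
  "mpt_inv M T = (SOME S. measure_preserving_map M S \<and> (AE x in M. S (T x) = x) \<and> (AE x in M. T (S x) = x))"

text \<open>The image \<open>T A\<close> of a set (well-defined mod 0): the preimage under the inverse.\<close>
definition mpt_img :: "'a measure \<Rightarrow> ('a \<Rightarrow> 'a) \<Rightarrow> 'a set \<Rightarrow> 'a set" where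
  "mpt_img M T B = mpt_inv M T -` B \<inter> space M"

definition mpt_preimg :: "'a measure \<Rightarrow> ('a \<Rightarrow> 'a) \<Rightarrow> 'a set \<Rightarrow> 'a set" where
  "mpt_preimg M T B = T -` B \<inter> space M"

definition symdiff :: "'a set \<Rightarrow> 'a set \<Rightarrow> 'a set" where
  "symdiff B C = (B - C) \<union> (C - B)"

definition dist_d :: "'a measure \<Rightarrow> (nat \<Rightarrow> 'a set) \<Rightarrow> ('a \<Rightarrow> 'a) \<Rightarrow> ('a \<Rightarrow> 'a) \<Rightarrow> real" where
  "dist_d M A T S = (\<Sum>i. (1/2) ^ i *
      (measure M (symdiff (mpt_img M T (A i)) (mpt_img M S (A i))) +
       measure M (symdiff (mpt_preimg M T (A i)) (mpt_preimg M S (A i)))))"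

definition dist_a :: "'a measure \<Rightarrow> (nat \<Rightarrow> 'a set) \<Rightarrow> ('a \<Rightarrow> 'a) \<Rightarrow> ('a \<Rightarrow> 'a) \<Rightarrow> real" where
  "dist_a M A T S = (\<Sum>i. \<Sum>j. (1/2) ^ (i + j) *
      \<bar>measure M (mpt_img M T (A i) \<inter> A j) - measure M (mpt_img M S (A i) \<inter> A j)\<bar>)"

text \<open>A Hausdorff locally compact topological group with a countable neighbourhood base
  (group operation written additively, not necessarily commutative).\<close>
definition lc_topological_group :: "'g::{group_add,t2_space,first_countable_topology} itself \<Rightarrow> bool" where
  "lc_topological_group _ \<longleftrightarrow>
     continuous_on UNIV (\<lambda>p::'g \<times> 'g. fst p + snd p) \<and>
     continuous_on UNIV (uminus :: 'g \<Rightarrow> 'g) \<and>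
     locally_compact_space (euclidean :: 'g topology)"

definition is_subgroup :: "'g::group_add set \<Rightarrow> bool" where
  "is_subgroup H \<longleftrightarrow> 0 \<in> H \<and> (\<forall>x\<in>H. \<forall>y\<in>H. x + y \<in> H) \<and> (\<forall>x\<in>H. - x \<in> H)"

definition generated_subgroup :: "'g::group_add set \<Rightarrow> 'g set" where
  "generated_subgroup S = \<Inter>{H. S \<subseteq> H \<and> is_subgroup H}"

definition unbounded_set :: "'g::topological_space set \<Rightarrow> bool" where
  "unbounded_set \<Gamma> \<longleftrightarrow> \<not> (\<exists>C. compact C \<and> \<Gamma> \<subseteq> C)"

definition is_action :: "'a measure \<Rightarrow> ('g::{group_add,topological_space} \<Rightarrow> 'a \<Rightarrow> 'a) \<Rightarrow> bool" where
  "is_action M T \<longleftrightarrow> (\<forall>g. invertible_mpt M (T g)) \<and>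
     (\<forall>g h. AE x in M. T g (T h x) = T (g + h) x) \<and>
     (\<forall>B \<in> sets M. \<forall>C \<in> sets M. continuous_on UNIV (\<lambda>g. measure M (mpt_img M (T g) B \<inter> C)))"

definition gamma_mixing :: "'a measure \<Rightarrow> 'g::{group_add,topological_space} set \<Rightarrow> ('g \<Rightarrow> 'a \<Rightarrow> 'a) \<Rightarrow> bool" where
  "gamma_mixing M \<Gamma> T \<longleftrightarrow> (\<forall>B \<in> sets M. \<forall>C \<in> sets M. \<forall>\<epsilon>>0. \<exists>K. compact K \<and>
     (\<forall>g \<in> \<Gamma> - K. \<bar>measure M (mpt_img M (T g) B \<inter> C) - measure M B * measure M C\<bar> < \<epsilon>))"

definition mixing_actions :: "'a measure \<Rightarrow> 'g::{group_add,topological_space} set \<Rightarrow> ('g \<Rightarrow> 'a \<Rightarrow> 'a) set" where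
  "mixing_actions M \<Gamma> = {T. is_action M T \<and> gamma_mixing M \<Gamma> T}"

definition action_equiv :: "'a measure \<Rightarrow> ('g \<Rightarrow> 'a \<Rightarrow> 'a) \<Rightarrow> ('g \<Rightarrow> 'a \<Rightarrow> 'a) \<Rightarrow> bool" where
  "action_equiv M T S \<longleftrightarrow> (\<forall>g. AE x in M. T g x = S g x)"

text \<open>The metric \<open>m_{G,\<Gamma>}\<close>; the family \<open>K_i\<close> is indexed by an at most countable set I of naturals.\<close>
definition metric_m :: "'a measure \<Rightarrow> (nat \<Rightarrow> 'a set) \<Rightarrow> nat set \<Rightarrow> (nat \<Rightarrow> 'g set) \<Rightarrow> 'g set \<Rightarrow>
    ('g \<Rightarrow> 'a \<Rightarrow> 'a) \<Rightarrow> ('g \<Rightarrow> 'a \<Rightarrow> 'a) \<Rightarrow> real" where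
  "metric_m M A I K \<Gamma> T S =
     (\<Sum>i. if i \<in> I then (1/2) ^ i * (SUP g\<in>K i. dist_d M A (T g) (S g)) else 0) +
     (SUP g\<in>\<Gamma>. dist_a M A (T g) (S g))"

end

theory Submission
  imports Defs
begin

text \<open>All distances between transformations are expressed through the pseudometric
  \<open>\<mu>(B \<triangle> C)\<close> on measurable sets, in which an action acts by isometries.

  For completeness, the set of \<open>g\<close> along which \<open>T\<^sub>n\<^sup>g B\<close> and \<open>T\<^sub>n\<^bsup>-g\<^esup> B\<close> are Cauchy for every \<open>B\<close> is
  a subgroup containing all \<open>K\<^sub>i\<close>, hence everything. A Cauchy sequence of transformations has a
  limit because, after identifying the space with the unit interval, a subsequence converges almost
  everywhere, and the limit is a random variable with Lebesgue distribution. Uniform convergence on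
  some \<open>K\<^sub>i\<close> gives continuity of the limit at one interior point, hence everywhere, and uniform
  convergence of the correlations on \<open>\<Gamma>\<close> preserves mixing.

  For separability, the group is \<open>\<sigma>\<close>-compact and first countable, hence second countable. Mixing
  reduces the comparison of two actions along \<open>\<Gamma>\<close> to a compact set, on which an action is described
  up to a small error by finitely many basic open sets and finitely many of the sets \<open>A\<^sub>i\<close>.\<close>

subsection \<open>The measure algebra\<close>

text \<open>Elements of the group are point maps known only up to null sets, and
  \<open>mpt_inv\<close> is an arbitrary choice among inverses. Equations between maps are therefore
  traded, wherever possible, for vanishing \<open>sdist\<close> between preimages or images. The
  price is paid at limits: convergence on sets alone yields only a map of the measure algebra, and a
  point map inducing it has to be produced. This is where the Lebesgue structure enters. The metric
  bounds nothing outside the \<open>K i\<close> and \<Gamma>, so information about other group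
  elements must travel by the group law. It can, because \<open>dist_d\<close> measures images and
  preimages together, hence controls g and -g at once, and because composing with an isometry does
  not enlarge errors. The group law also settles invertibility of a limit: limits are taken for each
  g separately, and the limit at -g turns out to invert the limit at g. Estimates are made on the
  sets \<open>A i\<close> and extended by density; replacing B by a nearby \<open>A k\<close> costs
  the same for every g, so uniformity in g survives.\<close>

definition sdist :: "'a measure \<Rightarrow> 'a set \<Rightarrow> 'a set \<Rightarrow> real" where
  "sdist M B C = measure M (symdiff B C)"

lemma symdiff_sets [measurable, simp, intro]:
  "B \<in> sets M \<Longrightarrow> C \<in> sets M \<Longrightarrow> symdiff B C \<in> sets M"
  by (auto simp: symdiff_def)

lemma sdist_commute: "sdist M B C = sdist M C B"
  by (simp add: sdist_def symdiff_def Un_commute)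

lemma sdist_nonneg [simp]: "0 \<le> sdist M B C"
  by (simp add: sdist_def)

lemma sdist_self [simp]: "sdist M B B = 0"
  by (simp add: sdist_def symdiff_def)

context prob_space
begin

lemma sdist_le_1 [simp]: "sdist M B C \<le> 1"
  by (simp add: sdist_def)

lemma sdist_triangle:
  assumes "B \<in> sets M" "C \<in> sets M" "D \<in> sets M"
  shows "sdist M B D \<le> sdist M B C + sdist M C D"
proof -
  have "measure M (symdiff B D) \<le> measure M (symdiff B C \<union> symdiff C D)"
    using assms by (intro finite_measure_mono) (auto simp: symdiff_def)
  also have "\<dots> \<le> measure M (symdiff B C) + measure M (symdiff C D)"
    using assms by (intro measure_Un_le) auto
  finally show ?thesis by (simp add: sdist_def)
qed

text \<open>Links the metric to correlations: images keep their measure, so continuity of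
  correlations in g becomes continuity of \<open>sdist\<close>, and for two sets of equal measure a
  one-sided difference determines the distance.\<close>

lemma sdist_eq:
  assumes "B \<in> sets M" "C \<in> sets M"
  shows "sdist M B C = measure M B + measure M C - 2 * measure M (B \<inter> C)"
proof -
  have "measure M (B - C \<union> (C - B)) = measure M (B - C) + measure M (C - B)"
    using assms by (intro finite_measure_Union) auto
  moreover have "measure M (B - C) = measure M B - measure M (B \<inter> C)"
    using assms by (simp add: finite_measure_Diff')
  moreover have "measure M (C - B) = measure M C - measure M (B \<inter> C)"
    using assms by (simp add: finite_measure_Diff' Int_commute)
  ultimately show ?thesis by (simp add: sdist_def symdiff_def)
qed

lemma measure_diff_le_sdist:
  assumes "B \<in> sets M" "C \<in> sets M"
  shows "\<bar>measure M B - measure M C\<bar> \<le> sdist M B C"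
proof -
  have "measure M (B \<inter> C) \<le> measure M B" "measure M (B \<inter> C) \<le> measure M C"
    using assms by (auto intro!: finite_measure_mono)
  then show ?thesis using sdist_eq[OF assms] by linarith
qed

lemma sdist_Int_le:
  assumes "B \<in> sets M" "C \<in> sets M" "D \<in> sets M"
  shows "sdist M (B \<inter> D) (C \<inter> D) \<le> sdist M B C"
  unfolding sdist_def using assms
  by (intro finite_measure_mono) (auto simp: symdiff_def)

text \<open>Correlations are 1-Lipschitz in each argument; through this, closeness of images turns
  into closeness of correlations.\<close>

lemma measure_Int_diff_le_sdist:
  assumes "B \<in> sets M" "C \<in> sets M" "D \<in> sets M"
  shows "\<bar>measure M (B \<inter> D) - measure M (C \<inter> D)\<bar> \<le> sdist M B C"
    and "\<bar>measure M (D \<inter> B) - measure M (D \<inter> C)\<bar> \<le> sdist M B C"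
proof -
  show "\<bar>measure M (B \<inter> D) - measure M (C \<inter> D)\<bar> \<le> sdist M B C"
    using measure_diff_le_sdist[of "B \<inter> D" "C \<inter> D"] sdist_Int_le[OF assms] assms by auto
  then show "\<bar>measure M (D \<inter> B) - measure M (D \<inter> C)\<bar> \<le> sdist M B C"
    by (simp add: Int_commute)
qed

lemma sdist_eq_0_iff:
  assumes "B \<in> sets M" "C \<in> sets M"
  shows "sdist M B C = 0 \<longleftrightarrow> (AE x in M. x \<in> B \<longleftrightarrow> x \<in> C)"
proof -
  have "sdist M B C = 0 \<longleftrightarrow> symdiff B C \<in> null_sets M"
    unfolding sdist_def using assms by (auto simp: null_sets_def emeasure_eq_measure)
  also have "\<dots> \<longleftrightarrow> (AE x in M. x \<notin> symdiff B C)"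
    using assms by (intro AE_iff_null_sets) auto
  also have "\<dots> \<longleftrightarrow> (AE x in M. x \<in> B \<longleftrightarrow> x \<in> C)"
    by (intro AE_cong) (auto simp: symdiff_def)
  finally show ?thesis .
qed

text \<open>Replaces passing to the quotient by null sets: representatives may be exchanged inside
  \<open>sdist\<close>.\<close>

lemma sdist_cong_0:
  assumes "B \<in> sets M" "C \<in> sets M" "B' \<in> sets M" "C' \<in> sets M"
    "sdist M B B' = 0" "sdist M C C' = 0"
  shows "sdist M B C = sdist M B' C'"
  using sdist_triangle[OF assms(1,3,2)] sdist_triangle[OF assms(3,4,2)] sdist_triangle[OF assms(3,1,4)]
    sdist_triangle[OF assms(1,2,4)] sdist_commute[of M B B'] sdist_commute[of M C C'] assms(5,6)
  by linarith

end

subsection \<open>Measure-preserving maps\<close>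

lemma mpt_preimg_sets [simp, intro]:
  "measure_preserving_map M U \<Longrightarrow> B \<in> sets M \<Longrightarrow> mpt_preimg M U B \<in> sets M"
  by (auto simp: measure_preserving_map_def mpt_preimg_def)

lemma measure_preserving_map_distr:
  assumes "measure_preserving_map M U"
  shows "distr M M U = M"
  by (rule measure_eqI) (use assms in \<open>auto simp: measure_preserving_map_def emeasure_distr\<close>)

lemma measure_preserving_map_AE:
  assumes "measure_preserving_map M U" "AE x in M. P x"
  shows "AE x in M. P (U x)"
proof -
  have U: "U \<in> measurable M M" using assms by (simp add: measure_preserving_map_def)
  have "AE x in distr M M U. P x"
    unfolding measure_preserving_map_distr[OF assms(1)] by (rule assms)
  then show ?thesis by (rule AE_distrD[OF U])
qed

lemma measure_preserving_map_id: "measure_preserving_map M (\<lambda>x. x)"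
  by (auto simp: measure_preserving_map_def)

lemma measure_preserving_map_comp:
  assumes "measure_preserving_map M U" "measure_preserving_map M V"
  shows "measure_preserving_map M (\<lambda>x. U (V x))"
  unfolding measure_preserving_map_def
proof (intro conjI ballI)
  have U: "U \<in> measurable M M" and V: "V \<in> measurable M M"
    using assms by (auto simp: measure_preserving_map_def)
  then show "(\<lambda>x. U (V x)) \<in> measurable M M" by measurable
  fix B assume B: "B \<in> sets M"
  have "(\<lambda>x. U (V x)) -` B \<inter> space M = V -` (U -` B \<inter> space M) \<inter> space M"
    using measurable_space[OF V] by auto
  then have "emeasure M ((\<lambda>x. U (V x)) -` B \<inter> space M) =
      emeasure M (V -` (U -` B \<inter> space M) \<inter> space M)" by (rule arg_cong)
  also have "\<dots> = emeasure M (U -` B \<inter> space M)"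
    using assms(2) measurable_sets[OF U B] unfolding measure_preserving_map_def by blast
  also have "\<dots> = emeasure M B"
    using assms(1) B unfolding measure_preserving_map_def by blast
  finally show "emeasure M ((\<lambda>x. U (V x)) -` B \<inter> space M) = emeasure M B" .
qed

lemma mpt_preimg_comp:
  assumes "measure_preserving_map M V"
  shows "mpt_preimg M V (mpt_preimg M U B) = mpt_preimg M (\<lambda>x. U (V x)) B"
proof -
  have "V x \<in> space M" if "x \<in> space M" for x
    using assms that by (auto simp: measure_preserving_map_def dest: measurable_space)
  then show ?thesis by (auto simp: mpt_preimg_def)
qed

lemma measure_mpt_preimg:
  "measure_preserving_map M U \<Longrightarrow> B \<in> sets M \<Longrightarrow> measure M (mpt_preimg M U B) = measure M B"
  by (simp add: measure_preserving_map_def measure_def mpt_preimg_def)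

lemma sdist_mpt_preimg:
  assumes "measure_preserving_map M U" "B \<in> sets M" "C \<in> sets M"
  shows "sdist M (mpt_preimg M U B) (mpt_preimg M U C) = sdist M B C"
proof -
  have "symdiff (mpt_preimg M U B) (mpt_preimg M U C) = mpt_preimg M U (symdiff B C)"
    by (auto simp: symdiff_def mpt_preimg_def)
  then show ?thesis using assms by (simp add: sdist_def measure_mpt_preimg)
qed

lemma (in prob_space) sdist_mpt_preimg_AE:
  assumes "measure_preserving_map M U" "measure_preserving_map M V" "B \<in> sets M"
    "AE x in M. U x = V x"
  shows "sdist M (mpt_preimg M U B) (mpt_preimg M V B) = 0"
proof -
  have "AE x in M. x \<in> mpt_preimg M U B \<longleftrightarrow> x \<in> mpt_preimg M V B"
    using assms(4) by eventually_elim (simp add: mpt_preimg_def)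
  then show ?thesis using assms by (simp add: sdist_eq_0_iff)
qed

lemma mpt_inv_properties:
  assumes "invertible_mpt M U"
  shows "measure_preserving_map M (mpt_inv M U)"
    and "AE x in M. mpt_inv M U (U x) = x" and "AE x in M. U (mpt_inv M U x) = x"
proof -
  let ?P = "\<lambda>S. measure_preserving_map M S \<and> (AE x in M. S (U x) = x) \<and> (AE x in M. U (S x) = x)"
  have "\<exists>S. ?P S" using assms by (simp add: invertible_mpt_def)
  then have "?P (mpt_inv M U)" unfolding mpt_inv_def by (rule someI_ex)
  then show "measure_preserving_map M (mpt_inv M U)"
    "AE x in M. mpt_inv M U (U x) = x" "AE x in M. U (mpt_inv M U x) = x" by simp_all
qed

lemma mpt_img_eq_preimg: "mpt_img M U = mpt_preimg M (mpt_inv M U)"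
  by (auto simp: mpt_img_def mpt_preimg_def)

text \<open>Makes the choice in \<open>mpt_inv\<close> harmless. Pull \<open>V (U y) = y\<close>
  back to y = \<open>mpt_inv M U x\<close>, which is legitimate because that map preserves null
  sets, and use that U sends this y to x.\<close>

lemma mpt_inv_AE_unique:
  assumes U: "invertible_mpt M U" and V: "measure_preserving_map M V"
    and VU: "AE x in M. V (U x) = x"
  shows "AE x in M. mpt_inv M U x = V x"
proof -
  note * = mpt_inv_properties[OF U]
  from measure_preserving_map_AE[OF *(1) VU] *(3)
  show ?thesis by eventually_elim simp
qed

subsection \<open>Actions\<close>

text \<open>Kept apart from continuity because the limit of a Cauchy sequence is first known only as
  such a family; the metric estimates must already be available for it when its continuity is
  derived.\<close>

definition alg_action :: "'a measure \<Rightarrow> ('g::group_add \<Rightarrow> 'a \<Rightarrow> 'a) \<Rightarrow> bool" where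
  "alg_action M T \<longleftrightarrow> (\<forall>g. invertible_mpt M (T g)) \<and> (\<forall>g h. AE x in M. T g (T h x) = T (g + h) x)"

lemma is_action_iff:
  "is_action M T \<longleftrightarrow> alg_action M T \<and>
     (\<forall>B \<in> sets M. \<forall>C \<in> sets M. continuous_on UNIV (\<lambda>g. measure M (mpt_img M (T g) B \<inter> C)))"
  by (auto simp: is_action_def alg_action_def)

context
  fixes M :: "'a measure" and T :: "'g::group_add \<Rightarrow> 'a \<Rightarrow> 'a"
  assumes act: "alg_action M T"
begin

lemma action_invertible: "invertible_mpt M (T g)"
  using act by (simp add: alg_action_def)

lemma action_mp: "measure_preserving_map M (T g)"
  using action_invertible by (auto simp: invertible_mpt_def)

lemma action_add: "AE x in M. T g (T h x) = T (g + h) x"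
  using act by (simp add: alg_action_def)

text \<open>\<open>T 0\<close> is idempotent almost everywhere, and an invertible idempotent is the
  identity.\<close>

lemma action_0: "AE x in M. T 0 x = x"
proof -
  note * = mpt_inv_properties[OF action_invertible[of 0]]
  have "AE x in M. T 0 (T 0 x) = T 0 x" using action_add[of 0 0] by simp
  with measure_preserving_map_AE[OF action_mp *(2), of 0] *(2) show ?thesis
    by eventually_elim simp
qed

lemma action_inv: "AE x in M. mpt_inv M (T g) x = T (- g) x"
proof (rule mpt_inv_AE_unique)
  show "AE x in M. T (- g) (T g x) = x"
    using action_add[of "- g" g] action_0 by eventually_elim simp
qed (auto intro: action_invertible action_mp)

lemma action_inv_mp: "measure_preserving_map M (mpt_inv M (T g))"
  using mpt_inv_properties[OF action_invertible] by simp

lemma action_img_sets [simp, intro]: "B \<in> sets M \<Longrightarrow> mpt_img M (T g) B \<in> sets M"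
  by (simp add: mpt_img_eq_preimg action_inv_mp)

lemma measure_action_img: "B \<in> sets M \<Longrightarrow> measure M (mpt_img M (T g) B) = measure M B"
  by (simp add: mpt_img_eq_preimg action_inv_mp measure_mpt_preimg)

lemma sdist_action_img:
  "B \<in> sets M \<Longrightarrow> C \<in> sets M \<Longrightarrow> sdist M (mpt_img M (T g) B) (mpt_img M (T g) C) = sdist M B C"
  by (simp add: mpt_img_eq_preimg action_inv_mp sdist_mpt_preimg)

lemma action_img_Int: "mpt_img M (T g) (B \<inter> C) = mpt_img M (T g) B \<inter> mpt_img M (T g) C"
  by (auto simp: mpt_img_def)

text \<open>Images are preimages under inverses, and inversion reverses the order of a product;
  \<open>minus_add\<close> supplies exactly that reversal in a group that need not commute.\<close>

lemma sdist_action_img_add: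
  assumes "prob_space M" "B \<in> sets M"
  shows "sdist M (mpt_img M (T (g + h)) B) (mpt_img M (T g) (mpt_img M (T h) B)) = 0"
proof -
  interpret prob_space M by fact
  let ?V = "\<lambda>g. mpt_inv M (T g)"
  have "AE x in M. ?V (g + h) x = ?V h (?V g x)"
    using action_inv[of "g + h"] measure_preserving_map_AE[OF action_inv_mp[of g] action_inv[of h]]
      action_inv[of g] action_add[of "- h" "- g"]
  proof eventually_elim
    case (elim x)
    have "?V (g + h) x = T (- h + - g) x" using elim(1) unfolding minus_add .
    also have "\<dots> = T (- h) (T (- g) x)" by (rule elim(4)[symmetric])
    also have "\<dots> = T (- h) (?V g x)" unfolding elim(3) ..
    also have "\<dots> = ?V h (?V g x)" by (rule elim(2)[symmetric])
    finally show ?case .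
  qed
  then show ?thesis
    using assms unfolding mpt_img_eq_preimg mpt_preimg_comp[OF action_inv_mp]
    by (intro sdist_mpt_preimg_AE measure_preserving_map_comp[OF action_inv_mp action_inv_mp] action_inv_mp)
qed

lemma sdist_action_img_0:
  assumes "prob_space M" "B \<in> sets M"
  shows "sdist M (mpt_img M (T 0) B) B = 0"
proof -
  interpret prob_space M by fact
  have "AE x in M. mpt_inv M (T 0) x = x"
    using action_inv[of 0] action_0 by eventually_elim simp
  then have "sdist M (mpt_preimg M (mpt_inv M (T 0)) B) (mpt_preimg M (\<lambda>x. x) B) = 0"
    using assms by (intro sdist_mpt_preimg_AE action_inv_mp measure_preserving_map_id) auto
  moreover have "mpt_preimg M (\<lambda>x. x) B = B"
    using assms sets.sets_into_space by (auto simp: mpt_preimg_def)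
  ultimately show ?thesis by (simp add: mpt_img_eq_preimg)
qed

lemma sdist_action_preimg_img:
  assumes "prob_space M" "B \<in> sets M"
  shows "sdist M (mpt_preimg M (T g) B) (mpt_img M (T (- g)) B) = 0"
proof -
  interpret prob_space M by fact
  have "AE x in M. T g x = mpt_inv M (T (- g)) x"
    using action_inv[of "- g"] by eventually_elim simp
  then show ?thesis
    using assms unfolding mpt_img_eq_preimg
    by (intro sdist_mpt_preimg_AE action_mp action_inv_mp) auto
qed

end

lemma continuous_on_action:
  assumes "is_action M T" "B \<in> sets M" "C \<in> sets M"
  shows "continuous_on UNIV (\<lambda>g. measure M (mpt_img M (T g) B \<inter> C))"
  using assms by (simp add: is_action_def)

lemma (in prob_space) continuous_on_sdist_action:
  assumes T: "is_action M T" and "B \<in> sets M" "C \<in> sets M"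
  shows "continuous_on UNIV (\<lambda>g. sdist M (mpt_img M (T g) B) C)"
proof -
  have "alg_action M T" using T by (simp add: is_action_iff)
  moreover have "continuous_on UNIV (\<lambda>g. measure M B + measure M C - 2 * measure M (mpt_img M (T g) B \<inter> C))"
    using assms
    by (intro continuous_on_diff continuous_on_const continuous_on_mult_left continuous_on_action)
  ultimately show ?thesis using assms by (simp add: sdist_eq measure_action_img)
qed

subsection \<open>Point realisation in a Lebesgue space\<close>

text \<open>A coordinate \<open>\<phi>\<close> of the Lebesgue space through which transformations become real random
  variables: a transformation is recovered from any random variable distributed like \<open>\<phi>\<close>.\<close>

definition lebesgue_coordinate :: "'a measure \<Rightarrow> ('a \<Rightarrow> real) \<Rightarrow> bool" where
  "lebesgue_coordinate M \<phi> \<longleftrightarrow> \<phi> \<in> borel_measurable M \<and> (\<forall>x. 0 \<le> \<phi> x \<and> \<phi> x \<le> 1) \<and>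
     (\<exists>N\<in>null_sets M. inj_on \<phi> (space M - N)) \<and>
     (\<forall>B\<in>sets M. \<forall>e>0. \<exists>U. open U \<and> sdist M B (\<phi> -` U \<inter> space M) < e) \<and>
     (\<forall>F\<in>borel_measurable M. distr M borel F = distr M borel \<phi> \<longrightarrow>
        (\<exists>T. measure_preserving_map M T \<and> (AE x in M. \<phi> (T x) = F x)))"

lemma lebesgue_coordinate_exists:
  assumes "nonatomic_lebesgue_space M"
  shows "\<exists>\<phi>. lebesgue_coordinate M \<phi>"
proof -
  note emeasure_completion [simp del]
  let ?L = "lebesgue_on {0..1::real}"
  obtain N N' f where prob: "prob_space M" and N: "N \<in> null_sets M" and N': "N' \<in> null_sets ?L"
    and bij: "bij_betw f (space M - N) ({0..1} - N')"
    and sets_iff: "\<And>A. A \<subseteq> space M \<Longrightarrow> A \<in> sets M \<longleftrightarrow> f ` (A - N) \<in> sets ?L"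
    and em: "\<And>A. A \<in> sets M \<Longrightarrow> emeasure M A = emeasure ?L (f ` (A - N))"
    using assms unfolding nonatomic_lebesgue_space_def by blast
  interpret prob_space M by (rule prob)
  have null_L: "Z \<in> null_sets ?L \<longleftrightarrow> Z \<subseteq> {0..1} \<and> Z \<in> null_sets lebesgue" for Z
    by (subst null_sets_restrict_space) auto
  have sets_L: "Z \<in> sets ?L \<longleftrightarrow> Z \<subseteq> {0..1} \<and> Z \<in> sets lebesgue" for Z
    by (subst sets_restrict_space_iff) auto
  have em_L: "emeasure ?L Z = emeasure lebesgue Z" if "Z \<subseteq> {0..1}" for Z
    using that by (intro emeasure_restrict_space) auto
  have inj: "inj_on f (space M - N)" and img: "f ` (space M - N) = {0..1} - N'"
    using bij by (auto simp: bij_betw_def)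

  \<comment> \<open>The isomorphism is given through images, while random variables need preimages.
    The two agree up to N': the image of the preimage of Z is Z - N'.\<close>
  have pull: "{x \<in> space M - N. f x \<in> Z} \<in> sets M \<and>
      emeasure M {x \<in> space M - N. f x \<in> Z} = emeasure lebesgue Z"
    if Z: "Z \<in> sets ?L" for Z
  proof -
    let ?A = "{x \<in> space M - N. f x \<in> Z}"
    have img_A: "f ` (?A - N) = Z - N'"
    proof
      show "f ` (?A - N) \<subseteq> Z - N'" using img by auto
      show "Z - N' \<subseteq> f ` (?A - N)"
      proof
        fix z assume z: "z \<in> Z - N'"
        then have "z \<in> f ` (space M - N)" using img Z by (auto simp: sets_L)
        then obtain x where "x \<in> space M - N" "z = f x" by blast
        with z show "z \<in> f ` (?A - N)" by blast
      qed
    qed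
    have "?A \<in> sets M"
    proof (subst sets_iff)
      show "f ` (?A - N) \<in> sets ?L" unfolding img_A using Z N' by auto
    qed auto
    moreover from em[OF this] have "emeasure M ?A = emeasure ?L (Z - N')" unfolding img_A .
    moreover have "\<dots> = emeasure ?L Z" using Z N' by (intro emeasure_Diff_null_set) auto
    ultimately show ?thesis using Z by (simp add: em_L sets_L)
  qed

  \<comment> \<open>Completeness of M is inherited: \<open>sets_iff\<close> reads measurability off
    the image, and subsets of Lebesgue null sets are Lebesgue measurable.\<close>
  have complete_M: "Z \<in> null_sets M" if "Z \<subseteq> Y" "Y \<in> null_sets M" for Z Y
  proof -
    have "f ` (Y - N) \<in> null_sets ?L"
      using that em[of Y] sets_iff[of Y] sets.sets_into_space[of Y M] by (auto simp: null_sets_def)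
    then have Y: "f ` (Y - N) \<subseteq> {0..1}" "f ` (Y - N) \<in> null_sets lebesgue"
      unfolding null_L by auto
    have sub: "f ` (Z - N) \<subseteq> f ` (Y - N)" using that(1) by auto
    have "f ` (Z - N) \<in> null_sets ?L"
      unfolding null_L using sub Y(1) null_sets_completion_subset[OF sub Y(2)] by auto
    then have "f ` (Z - N) \<in> sets ?L" by (rule null_setsD2)
    then have "Z \<in> sets M"
      using that sets.sets_into_space[OF null_setsD2[OF that(2)]] sets_iff[of Z] by auto
    then show ?thesis by (rule null_sets_subset[OF that(2) _ that(1)])
  qed

  \<comment> \<open>The value 0 on the null set N is arbitrary within [0,1]; it makes \<phi> total
    and bounded.\<close>
  define \<phi> where "\<phi> x = (if x \<in> space M - N then f x else 0)" for x
  have phi_f: "\<phi> x = f x" if "x \<in> space M - N" for x using that by (simp add: \<phi>_def)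
  have phi_range: "0 \<le> \<phi> x \<and> \<phi> x \<le> 1" for x
    using img by (force simp: \<phi>_def)

  have phi_pull: "\<phi> -` Z \<inter> space M \<in> sets M \<and>
      emeasure M (\<phi> -` Z \<inter> space M) = emeasure lebesgue (Z \<inter> {0..1})"
    if "Z \<in> sets borel" for Z
  proof -
    let ?A = "{x \<in> space M - N. f x \<in> Z \<inter> {0..1}}"
    have A: "?A \<in> sets M" "emeasure M ?A = emeasure lebesgue (Z \<inter> {0..1})"
      using pull[of "Z \<inter> {0..1}"] that by (auto simp: sets_L)
    have eq: "\<phi> -` Z \<inter> space M = ?A \<union> (\<phi> -` Z \<inter> space M \<inter> N)"
      using img by (auto simp: \<phi>_def)
    have n: "\<phi> -` Z \<inter> space M \<inter> N \<in> null_sets M" by (rule complete_M[OF _ N]) auto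
    have "emeasure M (?A \<union> (\<phi> -` Z \<inter> space M \<inter> N)) = emeasure M ?A"
      by (rule emeasure_Un_null_set[OF A(1) n])
    moreover have "?A \<union> (\<phi> -` Z \<inter> space M \<inter> N) \<in> sets M"
      by (rule sets.Un[OF A(1) null_setsD2[OF n]])
    ultimately show ?thesis using A(2) eq by simp
  qed
  have phi_meas: "\<phi> \<in> borel_measurable M"
    using phi_pull by (intro measurableI) auto

  \<comment> \<open>Outer regularity of Lebesgue measure, applied to the image of B; U exceeds that
    image by measure less than e, and N contributes nothing.\<close>
  have dense: "\<exists>U. open U \<and> sdist M B (\<phi> -` U \<inter> space M) < e" if B: "B \<in> sets M" and e: "e > 0" for B e
  proof -
    let ?E = "f ` (B - N)"
    have E: "?E \<in> sets ?L" using B sets_iff[of B] sets.sets_into_space[of B M] by auto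
    then have "?E \<in> sets lebesgue" by (simp add: sets_L)
    then obtain U where U: "open U" "?E \<subseteq> U" "emeasure lebesgue (U - ?E) < ennreal e"
      using sets_lebesgue_outer_open[of ?E e] e by metis
    let ?A = "{x \<in> space M - N. f x \<in> (U - ?E) \<inter> {0..1}}"
    have "U \<in> sets lebesgue" using U by auto
    then have UE: "(U - ?E) \<inter> {0..1} \<in> sets ?L" using E by (auto simp: sets_L)
    have A: "?A \<in> sets M" using pull[OF UE] by simp
    have "emeasure M (symdiff B (\<phi> -` U \<inter> space M)) \<le> emeasure M (?A \<union> N)"
    proof (rule emeasure_mono)
      show "symdiff B (\<phi> -` U \<inter> space M) \<subseteq> ?A \<union> N"
      proof
        fix x assume x: "x \<in> symdiff B (\<phi> -` U \<inter> space M)"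
        show "x \<in> ?A \<union> N"
        proof (cases "x \<in> N")
          case False
          have xs: "x \<in> space M" using x sets.sets_into_space[OF B] by (auto simp: symdiff_def)
          have ph: "\<phi> x = f x" using False xs phi_f by auto
          have "f x \<in> {0..1}" using img False xs by blast
          show ?thesis
          proof (cases "x \<in> B")
            case True
            then have "f x \<in> U" using False U by auto
            then show ?thesis using x True ph xs by (auto simp: symdiff_def)
          next
            case nB: False
            then have "f x \<in> U" using x ph by (auto simp: symdiff_def)
            moreover have "f x \<notin> ?E"
            proof
              assume "f x \<in> ?E"
              then obtain y where y: "y \<in> B - N" "f x = f y" by auto
              then have "y \<in> space M - N" using sets.sets_into_space[OF B] by auto
              then have "x = y" using inj_onD[OF inj y(2)] False xs by auto
              then show False using y nB by auto
            qed
            ultimately show ?thesis using False xs \<open>f x \<in> {0..1}\<close> by auto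
          qed
        qed auto
      qed
      show "?A \<union> N \<in> sets M" using A N by auto
    qed
    also have "\<dots> = emeasure M ?A" by (rule emeasure_Un_null_set[OF A N])
    also have "\<dots> = emeasure lebesgue ((U - ?E) \<inter> {0..1})" using pull[OF UE] by simp
    also have "\<dots> \<le> emeasure lebesgue (U - ?E)"
      using \<open>U \<in> sets lebesgue\<close> E by (intro emeasure_mono) (auto simp: sets_L)
    also have "\<dots> < ennreal e" by (rule U)
    finally have "ennreal (sdist M B (\<phi> -` U \<inter> space M)) < ennreal e"
      by (simp add: sdist_def emeasure_eq_measure)
    then show ?thesis using U e by (auto simp: ennreal_less_iff)
  qed

  have realise: "\<exists>T. measure_preserving_map M T \<and> (AE x in M. \<phi> (T x) = F x)"
    if F: "F \<in> borel_measurable M" and dF: "distr M borel F = distr M borel \<phi>" for F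
  proof -
    have F_borel: "F -` Z \<inter> space M \<in> sets M \<and>
        emeasure M (F -` Z \<inter> space M) = emeasure lebesgue (Z \<inter> {0..1})"
      if Z: "Z \<in> sets borel" for Z
    proof -
      have "emeasure M (F -` Z \<inter> space M) = emeasure (distr M borel F) Z"
        using Z F by (simp add: emeasure_distr)
      also have "\<dots> = emeasure M (\<phi> -` Z \<inter> space M)"
        using Z phi_meas by (simp add: dF emeasure_distr)
      finally show ?thesis using F Z phi_pull[OF Z] by (simp add: measurable_sets)
    qed
    \<comment> \<open>Equality of distributions speaks of Borel sets only. A Lebesgue null set lies
      in a Borel null set, and completeness of M handles the subset; a general Lebesgue set is then
      a Borel set plus such a remainder.\<close>
    have F_null: "F -` Z \<inter> space M \<in> null_sets M" if Z: "Z \<in> null_sets lebesgue" for Z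
    proof -
      obtain Y where Y: "Y \<in> null_sets lborel" "Z \<subseteq> Y"
        using Z null_sets_completion_iff2[of Z lborel] by auto
      then have "Y \<in> sets borel" by auto
      have "emeasure lebesgue (Y \<inter> {0..1}) = 0"
      proof -
        have "Y \<in> null_sets lebesgue" by (rule null_sets_completionI[OF Y(1)])
        then have "Y \<inter> {0..1} \<in> null_sets lebesgue"
          using null_sets_completion_subset[of "Y \<inter> {0..1}" Y lborel] by auto
        then show ?thesis by (rule null_setsD1)
      qed
      then have "F -` Y \<inter> space M \<in> null_sets M"
        using F_borel[OF \<open>Y \<in> sets borel\<close>] by auto
      then show ?thesis using complete_M Y(2) by (metis Int_mono order_refl vimage_mono)
    qed
    have F_leb: "F -` E \<inter> space M \<in> sets M \<and> emeasure M (F -` E \<inter> space M) = emeasure lebesgue E"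
      if E: "E \<in> sets ?L" for E
    proof -
      obtain S Y Y' where S: "E = S \<union> Y" "Y \<subseteq> Y'" "Y' \<in> null_sets lborel" "S \<in> sets borel"
        using E by (auto simp: sets_L elim!: sets_completionE)
      have Y: "Y \<in> null_sets lebesgue"
        using null_sets_completion_subset[OF S(2)] null_sets_completionI[OF S(3)] by auto
      have "S \<subseteq> {0..1}" using S E by (auto simp: sets_L)
      then have S1: "S \<inter> {0..1} = S" by auto
      have eq: "F -` E \<inter> space M = (F -` S \<inter> space M) \<union> (F -` Y \<inter> space M)" using S by auto
      have "emeasure M (F -` E \<inter> space M) = emeasure lebesgue S"
        using F_borel[OF S(4)] F_null[OF Y] by (simp add: eq emeasure_Un_null_set S1)
      also have "\<dots> = emeasure lebesgue E"
        unfolding S(1) using S(4) Y by (intro emeasure_Un_null_set[symmetric]) auto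
      finally show ?thesis using F_borel[OF S(4)] F_null[OF Y] by (auto simp: eq)
    qed
    obtain x0 where x0: "x0 \<in> space M" using not_empty by blast
    \<comment> \<open>T is the inverse of f applied to F. The point x0 serves only where F misses
      the range of f, which is a null set because F has the distribution of \<phi>.\<close>
    define T where "T x = (if F x \<in> {0..1} - N' then inv_into (space M - N) f (F x) else x0)" for x
    let ?G = "{x \<in> space M. F x \<in> {0..1} - N'}"
    have T_good: "T x \<in> space M - N \<and> f (T x) = F x" if "F x \<in> {0..1} - N'" for x
      using that img inv_into_into[of "F x" f "space M - N"] f_inv_into_f[of "F x" f "space M - N"]
      by (auto simp: T_def)
    have T_space: "T x \<in> space M" for x using T_good[of x] x0 by (auto simp: T_def)
    have "?G = F -` ({0..1} - N') \<inter> space M" by auto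
    have bad: "space M - ?G \<in> null_sets M"
    proof -
      have L: "{0..1} - N' \<in> sets ?L" using N' by (auto simp: sets_L null_L)
      have "emeasure lebesgue ({0..1} - N') = 1"
        using N' by (subst emeasure_Diff_null_set) (auto simp: null_L emeasure_completion)
      then have G: "?G \<in> sets M" "emeasure M ?G = 1"
        using F_leb[OF L] \<open>?G = _\<close> by auto
      have "emeasure M (space M - ?G) = emeasure M (space M) - emeasure M ?G"
        using G by (intro emeasure_Diff) auto
      then show ?thesis using G by (auto simp: emeasure_space_1)
    qed
    have T_pre: "T -` B \<inter> space M \<in> sets M \<and> emeasure M (T -` B \<inter> space M) = emeasure M B"
      if B: "B \<in> sets M" for B
    proof -
      let ?E = "f ` (B - N)"
      have E: "?E \<in> sets ?L" using B sets_iff[of B] sets.sets_into_space[of B M] by auto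
      have EN: "?E \<subseteq> {0..1} - N'" using img sets.sets_into_space[OF B] by auto
      have iff: "T x \<in> B \<longleftrightarrow> F x \<in> ?E" if "x \<in> ?G" for x
      proof
        assume "T x \<in> B"
        then show "F x \<in> ?E" using T_good[of x] that by force
      next
        assume "F x \<in> ?E"
        then obtain y where y: "y \<in> B - N" "F x = f y" by auto
        have "f (T x) = f y" using T_good[of x] that y by auto
        then have "T x = y"
          using T_good[of x] that y sets.sets_into_space[OF B] inj_onD[OF inj] by auto
        then show "T x \<in> B" using y by auto
      qed
      let ?R = "T -` B \<inter> (space M - ?G)"
      have eq: "T -` B \<inter> space M = (F -` ?E \<inter> space M) \<union> ?R"
        using iff EN by auto
      have R: "?R \<in> null_sets M" by (rule complete_M[OF _ bad]) auto
      have m: "F -` ?E \<inter> space M \<in> sets M" using F_leb[OF E] by simp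
      have "emeasure M (T -` B \<inter> space M) = emeasure lebesgue ?E"
        unfolding eq emeasure_Un_null_set[OF m R] using F_leb[OF E] by simp
      also have "\<dots> = emeasure M B" using em[OF B] em_L[of ?E] E by (auto simp: sets_L)
      finally show ?thesis unfolding eq using sets.Un[OF m null_setsD2[OF R]] by simp
    qed
    have "measure_preserving_map M T"
      unfolding measure_preserving_map_def using T_pre T_space by (auto intro!: measurableI)
    moreover have "AE x in M. \<phi> (T x) = F x"
    proof (rule AE_I'[OF bad])
      show "{x \<in> space M. \<phi> (T x) \<noteq> F x} \<subseteq> space M - ?G"
        using T_good phi_f by fastforce
    qed
    ultimately show ?thesis by blast
  qed
  have "inj_on \<phi> (space M - N)" using inj by (auto simp: inj_on_def phi_f)
  then show ?thesis
    unfolding lebesgue_coordinate_def using phi_meas phi_range dense realise N by blast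
qed

text \<open>Countably many sets, the cuts of \<phi> at rationals, determine \<phi> (U x) off a
  single null set. Both maps avoid N almost surely because they preserve null sets, and off N the
  coordinate separates points.\<close>

lemma (in prob_space) AE_eq_of_preimages:
  assumes phi: "lebesgue_coordinate M \<phi>"
    and U: "measure_preserving_map M U" and V: "measure_preserving_map M V"
    and eq: "\<And>B. B \<in> sets M \<Longrightarrow> sdist M (mpt_preimg M U B) (mpt_preimg M V B) = 0"
  shows "AE x in M. U x = V x"
proof -
  obtain N where N: "N \<in> null_sets M" and inj: "inj_on \<phi> (space M - N)"
    using phi by (auto simp: lebesgue_coordinate_def)
  have [measurable]: "\<phi> \<in> borel_measurable M" using phi by (auto simp: lebesgue_coordinate_def)
  define B where "B q = {x \<in> space M. \<phi> x < real_of_rat q}" for q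
  have B: "B q \<in> sets M" for q unfolding B_def by measurable
  have "AE x in M. \<forall>q. x \<in> mpt_preimg M U (B q) \<longleftrightarrow> x \<in> mpt_preimg M V (B q)"
    unfolding AE_all_countable using eq B U V by (auto simp flip: sdist_eq_0_iff)
  moreover have "AE x in M. x \<notin> N" using N by (rule AE_not_in)
  then have "AE x in M. U x \<notin> N" "AE x in M. V x \<notin> N"
    using measure_preserving_map_AE U V by blast+
  moreover note AE_space
  ultimately show ?thesis
  proof eventually_elim
    case (elim x)
    have sp: "U x \<in> space M" "V x \<in> space M"
      using U V elim by (auto simp: measure_preserving_map_def dest: measurable_space)
    have iff: "\<phi> (U x) < real_of_rat q \<longleftrightarrow> \<phi> (V x) < real_of_rat q" for q
      using elim(1)[rule_format, of q] sp elim(4) by (simp add: mpt_preimg_def B_def)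
    have "\<phi> (U x) = \<phi> (V x)"
      by (metis iff linorder_less_linear of_rat_dense order_less_asym)
    then show ?case using inj_onD[OF inj] sp elim by auto
  qed
qed

text \<open>Boundedness gives a cluster point l. A rational strictly between l and any other value
  separates the two: comparison with it is eventually constant, and the subsequence decides which
  way. So the whole sequence tends to l.\<close>

lemma convergent_of_rat_cuts:
  fixes u :: "nat \<Rightarrow> real"
  assumes bdd: "bounded (range u)"
    and cut: "\<And>q. eventually (\<lambda>k. (u (Suc k) < real_of_rat q) = (u k < real_of_rat q)) sequentially"
  shows "convergent u"
proof -
  have cut': "eventually (\<lambda>k. u k < real_of_rat q) sequentially \<or> eventually (\<lambda>k. \<not> u k < real_of_rat q) sequentially" for q
  proof -
    obtain n where n: "\<And>k. k \<ge> n \<Longrightarrow> (u (Suc k) < real_of_rat q) = (u k < real_of_rat q)"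
      using cut[of q] by (auto simp: eventually_sequentially)
    have "(u k < real_of_rat q) = (u n < real_of_rat q)" if "k \<ge> n" for k
      using that by (induction k rule: dec_induct) (simp_all add: n)
    then show ?thesis unfolding eventually_sequentially by blast
  qed
  obtain l r where r: "strict_mono r" and l: "(u \<circ> r) \<longlonglongrightarrow> l"
    using bounded_imp_convergent_subsequence[OF bdd] by blast
  have "u \<longlonglongrightarrow> l"
  proof (rule order_tendstoI)
    fix a assume "a < l"
    then obtain q where q: "a < real_of_rat q" "real_of_rat q < l" using of_rat_dense by blast
    have "eventually (\<lambda>k. real_of_rat q < (u \<circ> r) k) sequentially" by (rule order_tendstoD(1)[OF l q(2)])
    then have "\<not> eventually (\<lambda>k. u k < real_of_rat q) sequentially"
      using r unfolding eventually_sequentially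
      by (metis comp_apply linorder_not_less nle_le order.asym seq_suble dual_order.trans)
    then have "eventually (\<lambda>k. \<not> u k < real_of_rat q) sequentially" using cut'[of q] by blast
    then show "eventually (\<lambda>k. a < u k) sequentially" by eventually_elim (use q in simp)
  next
    fix a assume "l < a"
    then obtain q where q: "l < real_of_rat q" "real_of_rat q < a" using of_rat_dense by blast
    have "eventually (\<lambda>k. (u \<circ> r) k < real_of_rat q) sequentially" by (rule order_tendstoD(2)[OF l q(1)])
    then have "\<not> eventually (\<lambda>k. \<not> u k < real_of_rat q) sequentially"
      using r unfolding eventually_sequentially
      by (metis comp_apply nle_le seq_suble dual_order.trans)
    then have "eventually (\<lambda>k. u k < real_of_rat q) sequentially" using cut'[of q] by blast
    then show "eventually (\<lambda>k. u k < a) sequentially" by eventually_elim (use q in simp)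
  qed
  then show ?thesis by (rule convergentI)
qed

text \<open>Characteristic functions have bounded continuous integrands, so dominated convergence
  applies at once, with no concern for discontinuities of a distribution function.\<close>

lemma (in prob_space) distr_eq_of_AE_limit:
  fixes F :: "nat \<Rightarrow> 'a \<Rightarrow> real"
  assumes [measurable]: "\<And>k. F k \<in> borel_measurable M" "G \<in> borel_measurable M" "\<phi> \<in> borel_measurable M"
    and distr: "\<And>k. distr M borel (F k) = distr M borel \<phi>"
    and lim: "AE x in M. (\<lambda>k. F k x) \<longlonglongrightarrow> G x"
  shows "distr M borel G = distr M borel \<phi>"
proof (rule Levy_uniqueness)
  have rd: "real_distribution (distr M borel H)" if "H \<in> borel_measurable M" for H
    using that prob_space_distr[of H borel]
    by (auto simp: real_distribution_def real_distribution_axioms_def)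
  show "real_distribution (distr M borel G)" "real_distribution (distr M borel \<phi>)"
    by (auto intro: rd)
  show "char (distr M borel G) = char (distr M borel \<phi>)"
  proof
    fix t
    have c: "char (distr M borel H) t = (CLINT x|M. iexp (t * H x))" if "H \<in> borel_measurable M" for H
      unfolding char_def using that by (subst integral_distr) auto
    have "(\<lambda>k. CLINT x|M. iexp (t * F k x)) \<longlonglongrightarrow> (CLINT x|M. iexp (t * G x))"
    proof (rule integral_dominated_convergence[where w = "\<lambda>_. 1"])
      show "AE x in M. (\<lambda>k. iexp (t * F k x)) \<longlonglongrightarrow> iexp (t * G x)"
        using lim by eventually_elim (auto intro!: tendsto_intros)
    qed auto
    moreover have "(CLINT x|M. iexp (t * F k x)) = char (distr M borel \<phi>) t" for k
      using c[of "F k"] distr[of k] by simp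
    ultimately show "char (distr M borel G) t = char (distr M borel \<phi>) t"
      using c[of G] by (simp add: LIMSEQ_const_iff)
  qed
qed

lemma (in prob_space) measure_tendsto_0:
  assumes [measurable]: "\<And>k. E k \<in> sets M"
    and "AE x in M. eventually (\<lambda>k. x \<notin> E k) sequentially"
  shows "(\<lambda>k. measure M (E k)) \<longlonglongrightarrow> 0"
proof -
  have "(\<lambda>k. \<integral>x. indicator (E k) x \<partial>M) \<longlonglongrightarrow> (\<integral>x. (0::real) \<partial>M)"
  proof (rule integral_dominated_convergence[where w = "\<lambda>_. 1"])
    show "AE x in M. (\<lambda>k. indicator (E k) x) \<longlonglongrightarrow> (0::real)"
      using assms(2)
    proof eventually_elim
      case (elim x)
      then have "eventually (\<lambda>k. indicator (E k) x = (0::real)) sequentially"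
        by eventually_elim simp
      then show ?case by (rule tendsto_eventually)
    qed
  qed (auto simp: indicator_def)
  then show ?thesis by simp
qed

text \<open>The space carries no topology in which maps could converge, hence the detour through
  \<phi>. Along a fast subsequence Borel-Cantelli makes every rational cut of the coordinate
  eventually constant at almost every x; the coordinates then converge, and their limit keeps the
  distribution of \<phi> and is realised by a point map.\<close>

lemma (in prob_space) measure_preserving_limit:
  assumes phi: "lebesgue_coordinate M \<phi>"
    and U: "\<And>n. measure_preserving_map M (U n)"
    and cauchy: "\<And>B e. B \<in> sets M \<Longrightarrow> e > 0 \<Longrightarrow>
      \<exists>n0. \<forall>m\<ge>n0. \<forall>n\<ge>n0. sdist M (mpt_preimg M (U m) B) (mpt_preimg M (U n) B) < e"
  shows "\<exists>V. measure_preserving_map M V \<and>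
    (\<forall>B\<in>sets M. (\<lambda>n. sdist M (mpt_preimg M (U n) B) (mpt_preimg M V B)) \<longlonglongrightarrow> 0)"
proof -
  have phi_meas [measurable]: "\<phi> \<in> borel_measurable M" and range: "\<And>x. 0 \<le> \<phi> x \<and> \<phi> x \<le> 1"
    and dense: "\<And>B e. B \<in> sets M \<Longrightarrow> e > 0 \<Longrightarrow> \<exists>W. open W \<and> sdist M B (\<phi> -` W \<inter> space M) < e"
    and realise: "\<And>F. F \<in> borel_measurable M \<Longrightarrow> distr M borel F = distr M borel \<phi> \<Longrightarrow>
        \<exists>T. measure_preserving_map M T \<and> (AE x in M. \<phi> (T x) = F x)"
    using phi by (auto simp: lebesgue_coordinate_def)
  have U_meas [measurable]: "U n \<in> measurable M M" for n
    using U by (auto simp: measure_preserving_map_def)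
  define B :: "nat \<Rightarrow> 'a set" where "B i = {x \<in> space M. \<phi> x < real_of_rat (from_nat i)}" for i
  have B: "B i \<in> sets M" for i unfolding B_def by measurable
  have "\<exists>n0. \<forall>i<k. \<forall>m\<ge>n0. \<forall>n\<ge>n0. sdist M (mpt_preimg M (U m) (B i)) (mpt_preimg M (U n) (B i)) < (1/2)^k" for k
  proof -
    have "\<forall>i. \<exists>n0. \<forall>m\<ge>n0. \<forall>n\<ge>n0. sdist M (mpt_preimg M (U m) (B i)) (mpt_preimg M (U n) (B i)) < (1/2)^k"
      using cauchy[OF B, of "(1/2)^k"] by simp
    then obtain f where f: "\<And>i m n. m \<ge> f i \<Longrightarrow> n \<ge> f i \<Longrightarrow>
        sdist M (mpt_preimg M (U m) (B i)) (mpt_preimg M (U n) (B i)) < (1/2)^k"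
      by metis
    have "f i \<le> (\<Sum>i<k. f i)" if "i < k" for i using that by (intro member_le_sum) auto
    then show ?thesis by (intro exI[of _ "\<Sum>i<k. f i"]) (auto intro!: f intro: order_trans)
  qed
  then obtain s where s: "\<And>k i m n. i < k \<Longrightarrow> m \<ge> s k \<Longrightarrow> n \<ge> s k \<Longrightarrow>
        sdist M (mpt_preimg M (U m) (B i)) (mpt_preimg M (U n) (B i)) < (1/2)^k"
    by metis
  \<comment> \<open>Summing makes r nondecreasing with \<open>r k\<close> at least
    \<open>s k\<close>, so \<open>r k\<close> and \<open>r (Suc k)\<close> both lie beyond
    \<open>s k\<close> and the distances of consecutive preimages are summable. Adding k sends r to
    infinity.\<close>
  define r where "r k = (\<Sum>j\<le>k. s j) + k" for k
  have r_ge: "s k \<le> r k" "k \<le> r k" "r k \<le> r (Suc k)" for k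
    unfolding r_def using member_le_sum[of k "{..k}" s] by auto
  have BC: "AE x in M. eventually (\<lambda>k. x \<in> space M -
      symdiff (mpt_preimg M (U (r k)) (B i)) (mpt_preimg M (U (r (Suc k))) (B i))) sequentially" for i
  proof (rule borel_cantelli_AE1)
    show "symdiff (mpt_preimg M (U (r k)) (B i)) (mpt_preimg M (U (r (Suc k))) (B i)) \<in> sets M" for k
      using U B by auto
    show "summable (\<lambda>k. measure M (symdiff (mpt_preimg M (U (r k)) (B i)) (mpt_preimg M (U (r (Suc k))) (B i))))"
    proof (rule summable_comparison_test_ev)
      have "norm (measure M (symdiff (mpt_preimg M (U (r k)) (B i)) (mpt_preimg M (U (r (Suc k))) (B i))))
          \<le> (1/2)^k" if "k > i" for k
        using s[of i k "r k" "r (Suc k)"] that r_ge[of k] by (simp add: sdist_def)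
      then show "eventually (\<lambda>k. norm (measure M (symdiff (mpt_preimg M (U (r k)) (B i)) (mpt_preimg M (U (r (Suc k))) (B i))))
          \<le> (1/2)^k) sequentially"
        by (intro eventually_mono[OF eventually_gt_at_top[of i]])
      show "summable (\<lambda>k. (1/2::real)^k)" by (intro summable_geometric) auto
    qed
  qed (auto simp: less_top[symmetric])
  have conv: "AE x in M. convergent (\<lambda>k. \<phi> (U (r k) x))"
  proof -
    have "AE x in M. \<forall>i. eventually (\<lambda>k. x \<in> space M -
      symdiff (mpt_preimg M (U (r k)) (B i)) (mpt_preimg M (U (r (Suc k))) (B i))) sequentially"
      using BC by (simp add: AE_all_countable)
    then show ?thesis
    proof eventually_elim
      case (elim x)
      show ?case
      proof (rule convergent_of_rat_cuts)
        show "bounded (range (\<lambda>k. \<phi> (U (r k) x)))"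
          using range by (intro boundedI[of _ 1]) auto
        fix q :: rat
        have q: "from_nat (to_nat q) = q" by simp
        show "eventually (\<lambda>k. (\<phi> (U (r (Suc k)) x) < real_of_rat q) = (\<phi> (U (r k) x) < real_of_rat q)) sequentially"
          using elim[rule_format, of "to_nat q"]
        proof eventually_elim
          case (elim k)
          then have "U (r k) x \<in> space M" "U (r (Suc k)) x \<in> space M"
            using measurable_space[OF U_meas] by auto
          then show ?case using elim by (auto simp: symdiff_def mpt_preimg_def B_def)
        qed
      qed
    qed
  qed
  define F where "F x = lim (\<lambda>k. \<phi> (U (r k) x))" for x
  have F_meas [measurable]: "F \<in> borel_measurable M" unfolding F_def by measurable
  have F_lim: "AE x in M. (\<lambda>k. \<phi> (U (r k) x)) \<longlonglongrightarrow> F x"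
    using conv by eventually_elim (simp add: F_def convergent_LIMSEQ_iff)
  have dU: "distr M borel (\<lambda>x. \<phi> (U n x)) = distr M borel \<phi>" for n
  proof -
    have "distr M borel (\<lambda>x. \<phi> (U n x)) = distr (distr M M (U n)) borel \<phi>"
      by (subst distr_distr) (auto simp: comp_def)
    then show ?thesis by (simp add: measure_preserving_map_distr[OF U])
  qed
  have dF: "distr M borel F = distr M borel \<phi>"
    by (rule distr_eq_of_AE_limit[OF _ _ _ _ F_lim]) (auto simp: dU)
  obtain V where V: "measure_preserving_map M V" and VF: "AE x in M. \<phi> (V x) = F x"
    using realise[OF F_meas dF] by blast
  have V_meas [measurable]: "V \<in> measurable M M" using V by (auto simp: measure_preserving_map_def)

  let ?pre = "\<lambda>W. \<phi> -` W \<inter> space M"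
  have pre [simp, measurable]: "?pre W \<in> sets M" if "open W" for W
    using that by (intro measurable_sets[OF phi_meas]) auto
  text \<open>If \<open>F x\<close> lies in an open set, so do almost all \<open>\<phi> (U (r k) x)\<close>; as all these preimages
    have the same measure, this one-sided statement already gives convergence.\<close>
  have open_conv: "(\<lambda>k. sdist M (mpt_preimg M (U (r k)) (?pre W)) (mpt_preimg M V (?pre W))) \<longlonglongrightarrow> 0"
    if W: "open W" for W
  proof -
    let ?P = "\<lambda>k. mpt_preimg M (U (r k)) (?pre W)" and ?Q = "mpt_preimg M V (?pre W)"
    have m: "?P k \<in> sets M" "?Q \<in> sets M" for k using U V pre[OF W] by auto
    \<comment> \<open>Both sets have the measure of the set they are preimages of, so the two halves
      of their symmetric difference have equal measure.\<close>
    have eq: "sdist M (?P k) ?Q = 2 * measure M (?Q - ?P k)" for k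
      using sdist_eq[OF m] measure_mpt_preimg[OF U pre[OF W]] measure_mpt_preimg[OF V pre[OF W]]
        finite_measure_Diff'[OF m(2) m(1), of k]
      by (simp add: Int_commute)
    have "(\<lambda>k. measure M (?Q - ?P k)) \<longlonglongrightarrow> 0"
    proof (rule measure_tendsto_0)
      show "AE x in M. eventually (\<lambda>k. x \<notin> ?Q - ?P k) sequentially"
        using F_lim VF
      proof eventually_elim
        case (elim x)
        show ?case
        proof (cases "x \<in> ?Q")
          case True
          then have "F x \<in> W" "x \<in> space M" using elim by (auto simp: mpt_preimg_def)
          then have "eventually (\<lambda>k. \<phi> (U (r k) x) \<in> W) sequentially"
            using topological_tendstoD[OF elim(1) W] by simp
          then show ?thesis
            by eventually_elim
              (use \<open>x \<in> space M\<close> measurable_space[OF U_meas] in \<open>auto simp: mpt_preimg_def\<close>)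
        qed auto
      qed
    qed (use m in auto)
    then have "(\<lambda>k. 2 * measure M (?Q - ?P k)) \<longlonglongrightarrow> 2 * 0" by (intro tendsto_intros)
    then show ?thesis by (simp add: eq)
  qed
  have "(\<lambda>n. sdist M (mpt_preimg M (U n) C) (mpt_preimg M V C)) \<longlonglongrightarrow> 0" if C: "C \<in> sets M" for C
  proof (rule LIMSEQ_I)
    fix e :: real assume e: "e > 0"
    obtain W where W: "open W" "sdist M C (?pre W) < e / 4" using dense[OF C, of "e/4"] e by auto
    obtain n0 where n0: "\<And>m n. m \<ge> n0 \<Longrightarrow> n \<ge> n0 \<Longrightarrow> sdist M (mpt_preimg M (U m) C) (mpt_preimg M (U n) C) < e / 4"
      using cauchy[OF C, of "e/4"] e by auto
    obtain k0 where k0: "\<And>k. k \<ge> k0 \<Longrightarrow> sdist M (mpt_preimg M (U (r k)) (?pre W)) (mpt_preimg M V (?pre W)) < e / 4"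
      using LIMSEQ_D[OF open_conv[OF W(1)], of "e/4"] e by auto
    show "\<exists>no. \<forall>n\<ge>no. norm (sdist M (mpt_preimg M (U n) C) (mpt_preimg M V C) - 0) < e"
    proof (intro exI allI impI)
      fix n assume n: "n \<ge> n0"
      define k where "k = max n0 k0"
      have k: "r k \<ge> n0" "k \<ge> k0" using r_ge(2)[of k] by (auto simp: k_def)
      note m = mpt_preimg_sets[OF U C] mpt_preimg_sets[OF V C]
        mpt_preimg_sets[OF U pre[OF W(1)]] mpt_preimg_sets[OF V pre[OF W(1)]]
      \<comment> \<open>Four errors of e/4: from n to \<open>r k\<close> on C by the Cauchy
        property, from C to W under \<open>U (r k)\<close>, from \<open>U (r k)\<close> to V on W,
        and from W back to C under V. The second and fourth are isometric copies of the distance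
        between C and the preimage of W.\<close>
      have "sdist M (mpt_preimg M (U n) C) (mpt_preimg M V C) < e"
        using sdist_triangle[OF m(1) m(1) m(2), of n "r k"] sdist_triangle[OF m(1) m(3) m(2), of "r k" "r k"]
          sdist_triangle[OF m(3) m(4) m(2), of "r k"] n0[OF n k(1)] k0[OF k(2)] W(2)
          sdist_mpt_preimg[OF U C pre[OF W(1)], of "r k"] sdist_mpt_preimg[OF V pre[OF W(1)] C]
          sdist_commute[of M C "?pre W"]
        by linarith
      then show "norm (sdist M (mpt_preimg M (U n) C) (mpt_preimg M V C) - 0) < e" by simp
    qed
  qed
  then show ?thesis using V by blast
qed

subsection \<open>Dyadically weighted sums\<close>

definition dyadic_sum :: "(nat \<Rightarrow> real) \<Rightarrow> real" where
  "dyadic_sum b = (\<Sum>i. (1/2) ^ i * b i)"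

lemma suminf_half: "(\<Sum>i. (1/2::real) ^ i) = 2"
  using suminf_geometric[of "1/2::real"] by simp

lemma summable_half: "summable (\<lambda>i. (1/2::real) ^ i)"
  by (intro summable_geometric) auto

context
  fixes b :: "nat \<Rightarrow> real" and c :: real
  assumes nonneg: "\<And>i. 0 \<le> b i" and bounded: "\<And>i. b i \<le> c"
begin

lemma dyadic_summable: "summable (\<lambda>i. (1/2) ^ i * b i)"
  by (rule summable_comparison_test'[where N = 0, OF summable_mult2[OF summable_half, of c]])
    (use nonneg bounded in \<open>auto intro: mult_left_mono\<close>)

lemma dyadic_sum_nonneg: "0 \<le> dyadic_sum b"
  unfolding dyadic_sum_def using nonneg by (intro suminf_nonneg dyadic_summable) auto

lemma dyadic_sum_le: "dyadic_sum b \<le> 2 * c"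
proof -
  have "dyadic_sum b \<le> (\<Sum>i. (1/2) ^ i * c)"
    unfolding dyadic_sum_def using bounded
    by (intro suminf_le dyadic_summable summable_mult2 summable_half) (auto intro: mult_left_mono)
  also have "\<dots> = 2 * c" using suminf_mult2[OF summable_half, of c] by (simp add: suminf_half)
  finally show ?thesis .
qed

lemma dyadic_sum_term: "b i \<le> 2 ^ i * dyadic_sum b"
proof -
  have "sum (\<lambda>i. (1/2) ^ i * b i) {i} \<le> dyadic_sum b"
    unfolding dyadic_sum_def using nonneg by (intro sum_le_suminf dyadic_summable) auto
  then have "2 ^ i * ((1/2) ^ i * b i) \<le> 2 ^ i * dyadic_sum b" by (intro mult_left_mono) auto
  then show ?thesis by (simp add: power_one_over)
qed

text \<open>All weights together give 2, those from N on give 2 * (1/2)^N. With \<delta> of order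
  (1/2)^N this converts control of finitely many terms into control of the sum.\<close>

lemma dyadic_sum_small:
  assumes small: "\<And>i. i < N \<Longrightarrow> b i \<le> \<delta>" and "0 \<le> \<delta>"
  shows "dyadic_sum b \<le> 2 * \<delta> + 2 * c * (1/2) ^ N"
proof -
  have "dyadic_sum b = (\<Sum>i. (1/2) ^ (i + N) * b (i + N)) + (\<Sum>i<N. (1/2) ^ i * b i)"
    unfolding dyadic_sum_def by (rule suminf_split_initial_segment[OF dyadic_summable])
  moreover have "(\<Sum>i<N. (1/2) ^ i * b i) \<le> (\<Sum>i<N. (1/2) ^ i * \<delta>)"
    using small by (intro sum_mono mult_left_mono) auto
  moreover have "(\<Sum>i<N. (1/2) ^ i * \<delta>) \<le> (\<Sum>i. (1/2) ^ i * \<delta>)"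
    using \<open>0 \<le> \<delta>\<close> by (intro sum_le_suminf summable_mult2 summable_half) auto
  moreover have "(\<Sum>i. (1/2) ^ i * \<delta>) = 2 * \<delta>"
    using suminf_mult2[OF summable_half, of \<delta>] by (simp add: suminf_half)
  moreover have "(\<Sum>i. (1/2) ^ (i + N) * b (i + N)) \<le> (\<Sum>i. (1/2) ^ i * ((1/2) ^ N * c))"
  proof (intro suminf_le summable_mult2 summable_half)
    show "summable (\<lambda>i. (1/2) ^ (i + N) * b (i + N))"
      using summable_ignore_initial_segment[OF dyadic_summable, of N] .
    show "(1/2) ^ (i + N) * b (i + N) \<le> (1/2) ^ i * ((1/2) ^ N * c)" for i
      using bounded[of "i + N"] by (simp add: power_add)
  qed
  moreover have "(\<Sum>i. (1/2) ^ i * ((1/2) ^ N * c)) = 2 * c * (1/2) ^ N"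
    using suminf_mult2[OF summable_half, of "(1/2) ^ N * c", symmetric] unfolding suminf_half by simp
  ultimately show ?thesis by linarith
qed

end

lemma dyadic_sum_triangle:
  assumes "\<And>i. 0 \<le> a i" "\<And>i. 0 \<le> b i" "\<And>i. 0 \<le> b' i" "\<And>i. b i \<le> c" "\<And>i. b' i \<le> c"
    "\<And>i. a i \<le> b i + b' i"
  shows "dyadic_sum a \<le> dyadic_sum b + dyadic_sum b'"
proof -
  have ac: "a i \<le> c + c" for i using assms(4,5,6)[of i] by linarith
  have "dyadic_sum a \<le> (\<Sum>i. (1/2) ^ i * b i + (1/2) ^ i * b' i)"
    unfolding dyadic_sum_def
  proof (intro suminf_le summable_add)
    show "(1/2) ^ i * a i \<le> (1/2) ^ i * b i + (1/2) ^ i * b' i" for i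
      using mult_left_mono[OF assms(6)[of i], of "(1/2) ^ i"] by (simp add: algebra_simps)
  qed (use assms ac dyadic_summable in blast)+
  also have "\<dots> = dyadic_sum b + dyadic_sum b'"
    unfolding dyadic_sum_def
    by (rule suminf_add[symmetric]) (use assms dyadic_summable in blast)+
  finally show ?thesis .
qed

text \<open>Dominated convergence for series. The head contributes at most 2 * e/8 and the tail less
  than e/2.\<close>

lemma dyadic_sum_tendsto_0:
  assumes nonneg: "\<And>n i. 0 \<le> b n i" and bounded: "\<And>n i. b n i \<le> c"
    and lim: "\<And>i. (\<lambda>n. b n i) \<longlonglongrightarrow> 0"
  shows "(\<lambda>n. dyadic_sum (b n)) \<longlonglongrightarrow> 0"
proof (rule LIMSEQ_I)
  fix e :: real assume e: "e > 0"
  have "0 \<le> c" using nonneg[of 0 0] bounded[of 0 0] by linarith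
  have "(\<lambda>N. 2 * c * (1/2) ^ N) \<longlonglongrightarrow> 2 * c * 0"
    by (intro tendsto_intros LIMSEQ_realpow_zero) auto
  then have "eventually (\<lambda>N. 2 * c * (1/2) ^ N < e / 2) sequentially"
    using e by (intro order_tendstoD(2)) auto
  then obtain N where N: "2 * c * (1/2) ^ N < e / 2" by (auto simp: eventually_sequentially)
  have "eventually (\<lambda>n. \<forall>i\<in>{..<N}. b n i < e / 8) sequentially"
    using order_tendstoD(2)[OF lim, of "e / 8"] e by (intro eventually_ball_finite ballI) auto
  then obtain n0 where n0: "\<And>n i. n \<ge> n0 \<Longrightarrow> i < N \<Longrightarrow> b n i < e / 8"
    by (auto simp: eventually_sequentially)
  have "norm (dyadic_sum (b n) - 0) < e" if "n \<ge> n0" for n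
    using dyadic_sum_small[of "b n" c N "e / 8"] dyadic_sum_nonneg[of "b n" c] nonneg bounded e N
      less_imp_le[OF n0[OF that]] by force
  then show "\<exists>no. \<forall>n\<ge>no. norm (dyadic_sum (b n) - 0) < e" by blast
qed

subsection \<open>Topological groups\<close>

lemma generated_subgroup_UNIV_D:
  "generated_subgroup S = UNIV \<Longrightarrow> S \<subseteq> H \<Longrightarrow> is_subgroup H \<Longrightarrow> H = UNIV"
  unfolding generated_subgroup_def by auto

lemma continuous_on_left_translation:
  fixes a :: "'g::{group_add,topological_space}"
  assumes "continuous_on UNIV (\<lambda>p::'g \<times> 'g. fst p + snd p)"
  shows "continuous_on UNIV ((+) a)"
proof -
  have "continuous_on UNIV ((\<lambda>p::'g \<times> 'g. fst p + snd p) \<circ> Pair a)"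
    by (intro continuous_on_compose continuous_on_subset[OF assms] continuous_intros) auto
  then show ?thesis by (simp add: comp_def)
qed

lemma open_left_translate:
  fixes a :: "'g::{group_add,topological_space}"
  assumes "continuous_on UNIV (\<lambda>p::'g \<times> 'g. fst p + snd p)" "open V"
  shows "open ((+) a ` V)"
proof -
  have "(+) a ` V = (+) (- a) -` V"
    by (auto simp: image_iff intro!: bexI[where x = "- a + _"])
  then show ?thesis using open_vimage[OF assms(2) continuous_on_left_translation[OF assms(1), of "- a"]] by simp
qed

lemma continuous_on_group_diff:
  assumes add: "continuous_on UNIV (\<lambda>p::'g \<times> 'g. fst p + snd p)"
    and minus: "continuous_on UNIV (uminus :: 'g::{group_add,topological_space} \<Rightarrow> 'g)"
  shows "continuous_on UNIV (\<lambda>p::'g \<times> 'g. fst p - snd p)"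
proof -
  have "continuous_on UNIV ((\<lambda>p::'g \<times> 'g. fst p + snd p) \<circ> (\<lambda>p. (fst p, - snd p)))"
    by (intro continuous_on_compose continuous_on_subset[OF add] continuous_on_Pair continuous_on_fst
        continuous_on_id continuous_on_compose2[OF minus] continuous_on_snd) auto
  then show ?thesis by (simp add: comp_def)
qed

text \<open>Differences of points of a compact set form a compact set, and a set containing 0 and
  closed under differences is a subgroup. So it suffices to iterate differences while adjoining one
  \<open>K n\<close> per stage.\<close>

lemma sigma_compact_of_generated:
  fixes K :: "nat \<Rightarrow> 'g::{group_add,topological_space} set"
  assumes add: "continuous_on UNIV (\<lambda>p::'g \<times> 'g. fst p + snd p)"
    and minus: "continuous_on UNIV (uminus :: 'g \<Rightarrow> 'g)"
    and K: "\<And>i. i \<in> I \<Longrightarrow> compact (K i)"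
    and gen: "\<And>H. (\<Union>i\<in>I. K i) \<subseteq> H \<Longrightarrow> is_subgroup H \<Longrightarrow> H = UNIV"
  shows "\<exists>C::nat \<Rightarrow> 'g set. (\<forall>n. compact (C n)) \<and> (\<Union>n. C n) = UNIV"
proof -
  \<comment> \<open>The point 0 makes the stages increase, since x = x - 0, and lets
    \<open>K n\<close> itself enter the next stage.\<close>
  define L where "L n = (if n \<in> I then K n else {}) \<union> {0}" for n
  define C where "C = rec_nat {} (\<lambda>n Z. (\<lambda>p. fst p - snd p) ` ((Z \<union> L n) \<times> (Z \<union> L n)))"
  have C_Suc: "C (Suc n) = (\<lambda>p. fst p - snd p) ` ((C n \<union> L n) \<times> (C n \<union> L n))" for n
    by (simp add: C_def)
  have comp: "compact (C n)" for n
  proof (induction n)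
    case 0
    then show ?case by (simp add: C_def)
  next
    case (Suc n)
    have "compact (L n)" unfolding L_def using K by auto
    then show ?case
      unfolding C_Suc using Suc
      by (intro compact_continuous_image continuous_on_subset[OF continuous_on_group_diff[OF add minus]]
          compact_Times compact_Un) auto
  qed
  have diff: "x - y \<in> C (Suc n)" if "x \<in> C n \<union> L n" "y \<in> C n \<union> L n" for x y n
    unfolding C_Suc using that by (intro image_eqI[of _ _ "(x, y)"]) auto
  have zero: "0 \<in> L n" for n by (simp add: L_def)
  have mono: "x \<in> C m" if "x \<in> C n" "n \<le> m" for x n m
    using that(2,1)
  proof (induction m rule: dec_induct)
    case (step m)
    then show ?case using diff[of x m 0] zero by simp
  qed
  have closed: "x - y \<in> (\<Union>n. C n)" if xy: "x \<in> (\<Union>n. C n)" "y \<in> (\<Union>n. C n)" for x y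
  proof -
    obtain n m where "x \<in> C n" "y \<in> C m" using xy by auto
    then have "x \<in> C (max n m)" "y \<in> C (max n m)" using mono by auto
    then show ?thesis using diff[of x "max n m" y] by blast
  qed
  have in0: "0 \<in> (\<Union>n. C n)" using diff[of 0 0 0] zero by auto
  have "is_subgroup (\<Union>n. C n)"
    unfolding is_subgroup_def
  proof (intro conjI ballI)
    show neg: "- x \<in> (\<Union>n. C n)" if "x \<in> (\<Union>n. C n)" for x using closed[OF in0 that] by simp
    show "x + y \<in> (\<Union>n. C n)" if "x \<in> (\<Union>n. C n)" "y \<in> (\<Union>n. C n)" for x y
      using closed[OF that(1) neg[OF that(2)]] by simp
  qed (rule in0)
  moreover have "K i \<subseteq> (\<Union>n. C n)" if "i \<in> I" for i
  proof
    fix x assume "x \<in> K i"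
    then show "x \<in> (\<Union>n. C n)" using diff[of x i 0] zero[of i] that by (auto simp: L_def)
  qed
  ultimately have "(\<Union>n. C n) = UNIV" by (intro gen) auto
  then show ?thesis using comp by blast
qed

text \<open>The base consists of the translates \<open>x + V\<close>, where \<open>V\<close> runs through a neighbourhood base of \<open>0\<close>
  and \<open>x\<close> through the centres of finite \<open>V\<close>-coverings of the compact sets exhausting the group.\<close>

lemma countable_base_of_sigma_compact:
  fixes C :: "nat \<Rightarrow> 'g::{group_add,t2_space,first_countable_topology} set"
  assumes add: "continuous_on UNIV (\<lambda>p::'g \<times> 'g. fst p + snd p)"
    and minus: "continuous_on UNIV (uminus :: 'g \<Rightarrow> 'g)"
    and C: "\<And>n. compact (C n)" "(\<Union>n. C n) = UNIV"
  shows "\<exists>b::nat \<Rightarrow> 'g set. (\<forall>n. open (b n)) \<and> (\<forall>W x. open W \<longrightarrow> x \<in> W \<longrightarrow> (\<exists>n. x \<in> b n \<and> b n \<subseteq> W))"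
proof -
  obtain V :: "nat \<Rightarrow> 'g set" where V: "\<And>i. open (V i)" "\<And>i. 0 \<in> V i"
    and V_base: "\<And>S. open S \<Longrightarrow> 0 \<in> S \<Longrightarrow> eventually (\<lambda>i. V i \<subseteq> S) sequentially"
    using countable_basis_at_decseq[of 0] by blast
  have open_tr: "open ((+) x ` V i)" for x i by (rule open_left_translate[OF add V(1)])
  have "\<exists>D. finite D \<and> C n \<subseteq> (\<Union>x\<in>D. (+) x ` V i)" for n i
  proof -
    have cov: "C n \<subseteq> (\<Union>x\<in>C n. (+) x ` V i)"
    proof
      fix x assume "x \<in> C n"
      then show "x \<in> (\<Union>x\<in>C n. (+) x ` V i)" using V(2)[of i] by (intro UN_I[of x] image_eqI[of _ _ 0]) auto
    qed
    show ?thesis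
      using compactE_image[OF C(1)[of n], of "C n" "\<lambda>x. (+) x ` V i"] open_tr cov by metis
  qed
  then obtain D where D: "\<And>n i. finite (D n i)" "\<And>n i. C n \<subseteq> (\<Union>x\<in>D n i. (+) x ` V i)" by metis
  define \<B> where "\<B> = (\<Union>n. \<Union>i. (\<lambda>x. (+) x ` V i) ` D n i)"
  have "countable \<B>"
    unfolding \<B>_def using countable_finite[OF D(1)] by (intro countable_UN countable_image) auto
  have base: "\<exists>B\<in>\<B>. x \<in> B \<and> B \<subseteq> W" if W: "open W" "x \<in> W" for W x
  proof -
    \<comment> \<open>If x = y + v, then \<open>?f (v, w)\<close> is y + w. Continuity at (0, 0),
      where the value is x, thus yields an i for which every translate y + \<open>V i\<close>
      containing x stays inside W, whatever its centre y.\<close>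
    let ?f = "\<lambda>p::'g \<times> 'g. x + (- fst p + snd p)"
    have "continuous_on UNIV ?f"
    proof -
      have "continuous_on UNIV (\<lambda>p::'g \<times> 'g. (- fst p, snd p))"
        by (intro continuous_on_Pair continuous_on_compose2[OF minus] continuous_on_fst continuous_on_snd
            continuous_on_id) auto
      from continuous_on_compose2[OF add this]
      have "continuous_on UNIV (\<lambda>p::'g \<times> 'g. - fst p + snd p)" by simp
      from continuous_on_compose2[OF continuous_on_left_translation[OF add] this] show ?thesis by simp
    qed
    then have "open (?f -` W)" using W(1) by (intro open_vimage)
    moreover have "(0, 0) \<in> ?f -` W" using W by simp
    ultimately obtain P Q where PQ: "open P" "open Q" "0 \<in> P" "0 \<in> Q" "P \<times> Q \<subseteq> ?f -` W"
      by (auto elim!: open_prod_elim)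
    then have "eventually (\<lambda>i. V i \<subseteq> P \<inter> Q) sequentially" by (intro V_base) auto
    then obtain i where i: "V i \<subseteq> P \<inter> Q" by (auto simp: eventually_sequentially)
    obtain n where "x \<in> C n" using C(2) by blast
    then obtain y v where y: "y \<in> D n i" "v \<in> V i" "x = y + v" using D(2)[of n i] by blast
    have "(+) y ` V i \<subseteq> W"
    proof
      fix z assume "z \<in> (+) y ` V i"
      then obtain w where w: "w \<in> V i" "z = y + w" by auto
      have "?f (v, w) \<in> W" using PQ(5) i y w by blast
      moreover have "?f (v, w) = z" using y w by (simp add: add.assoc)
      ultimately show "z \<in> W" by simp
    qed
    moreover have "(+) y ` V i \<in> \<B>" using y by (auto simp: \<B>_def)
    moreover have "x \<in> (+) y ` V i" using y by auto
    ultimately show ?thesis by blast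
  qed
  have ne: "\<B> \<noteq> {}" using base[of UNIV 0] by auto
  have "open B" if "B \<in> \<B>" for B using that open_tr by (auto simp: \<B>_def)
  moreover have "range (from_nat_into \<B>) = \<B>" by (rule range_from_nat_into[OF ne \<open>countable \<B>\<close>])
  ultimately show ?thesis using base by (intro exI[of _ "from_nat_into \<B>"]) (metis rangeI imageE)
qed

subsection \<open>The metric on actions\<close>

text \<open>\<open>generating\<close> is stated as an induction principle: a property that holds on
  every \<open>K i\<close> and whose solutions form a subgroup holds on the whole group.\<close>

locale mixing_space = prob_space M for M :: "'a measure" +
  fixes A :: "nat \<Rightarrow> 'a set" and I :: "nat set"
    and K :: "nat \<Rightarrow> 'g::{group_add,t2_space,first_countable_topology} set"
    and \<Gamma> :: "'g set" and \<phi> :: "'a \<Rightarrow> real"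
  assumes coordinate: "lebesgue_coordinate M \<phi>"
    and sets_A [simp, intro]: "A i \<in> sets M"
    and dense_A: "\<And>B e. B \<in> sets M \<Longrightarrow> 0 < e \<Longrightarrow> \<exists>i. sdist M B (A i) < e"
    and add_cont: "continuous_on UNIV (\<lambda>p::'g \<times> 'g. fst p + snd p)"
    and minus_cont: "continuous_on UNIV (uminus :: 'g \<Rightarrow> 'g)"
    and compact_K: "i \<in> I \<Longrightarrow> compact (K i)"
    and interior_K: "i \<in> I \<Longrightarrow> interior (K i) \<noteq> {}"
    and generating: "\<And>H. (\<Union>i\<in>I. K i) \<subseteq> H \<Longrightarrow> is_subgroup H \<Longrightarrow> H = UNIV"
    and unbounded_\<Gamma>: "unbounded_set \<Gamma>"
begin

abbreviation img :: "('g \<Rightarrow> 'a \<Rightarrow> 'a) \<Rightarrow> 'g \<Rightarrow> 'a set \<Rightarrow> 'a set" where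
  "img T g \<equiv> mpt_img M (T g)"

abbreviation d :: "('g \<Rightarrow> 'a \<Rightarrow> 'a) \<Rightarrow> ('g \<Rightarrow> 'a \<Rightarrow> 'a) \<Rightarrow> 'g \<Rightarrow> real" where
  "d T S g \<equiv> dist_d M A (T g) (S g)"

abbreviation a :: "('g \<Rightarrow> 'a \<Rightarrow> 'a) \<Rightarrow> ('g \<Rightarrow> 'a \<Rightarrow> 'a) \<Rightarrow> 'g \<Rightarrow> real" where
  "a T S g \<equiv> dist_a M A (T g) (S g)"

abbreviation m :: "('g \<Rightarrow> 'a \<Rightarrow> 'a) \<Rightarrow> ('g \<Rightarrow> 'a \<Rightarrow> 'a) \<Rightarrow> real" where
  "m \<equiv> metric_m M A I K \<Gamma>"

text \<open>The value 0 off I turns the sum over I into a \<open>dyadic_sum\<close> over all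
  naturals.\<close>

definition sup_d :: "('g \<Rightarrow> 'a \<Rightarrow> 'a) \<Rightarrow> ('g \<Rightarrow> 'a \<Rightarrow> 'a) \<Rightarrow> nat \<Rightarrow> real" where
  "sup_d T S i = (if i \<in> I then SUP g\<in>K i. d T S g else 0)"

definition sup_a :: "('g \<Rightarrow> 'a \<Rightarrow> 'a) \<Rightarrow> ('g \<Rightarrow> 'a \<Rightarrow> 'a) \<Rightarrow> real" where
  "sup_a T S = (SUP g\<in>\<Gamma>. a T S g)"

lemma K_nonempty: "i \<in> I \<Longrightarrow> K i \<noteq> {}"
  using interior_K[of i] interior_subset[of "K i"] by auto

lemma \<Gamma>_nonempty: "\<Gamma> \<noteq> {}"
  using unbounded_\<Gamma> unfolding unbounded_set_def using compact_empty by blast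

text \<open>With no sets \<open>K i\<close> the trivial subgroup would be everything, and \<Gamma>
  would lie in a single point, which is compact.\<close>

lemma I_nonempty: "I \<noteq> {}"
proof
  assume "I = {}"
  then have "{0::'g} = UNIV" by (intro generating) (auto simp: is_subgroup_def)
  then have "\<Gamma> \<subseteq> {0}" by blast
  then show False using unbounded_\<Gamma> unfolding unbounded_set_def by (meson compact_sing)
qed

lemma m_eq: "m T S = dyadic_sum (sup_d T S) + sup_a T S"
proof -
  have "(\<lambda>i. if i \<in> I then (1/2) ^ i * (SUP g\<in>K i. d T S g) else 0) = (\<lambda>i. (1/2) ^ i * sup_d T S i)"
    by (auto simp: sup_d_def)
  then show ?thesis by (simp add: metric_m_def dyadic_sum_def sup_a_def)
qed

lemma d_eq: "d T S g = dyadic_sum (\<lambda>i. sdist M (img T g (A i)) (img S g (A i)) +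
    sdist M (mpt_preimg M (T g) (A i)) (mpt_preimg M (S g) (A i)))"
  by (simp add: dist_d_def dyadic_sum_def sdist_def)

lemma d_terms: "0 \<le> sdist M B C + sdist M B' C'" "sdist M B C + sdist M B' C' \<le> 2"
  using sdist_le_1[of B C] sdist_le_1[of B' C'] sdist_nonneg[of M B C] sdist_nonneg[of M B' C'] by linarith+

lemma d_nonneg: "0 \<le> d T S g" and d_le: "d T S g \<le> 4"
proof -
  show "0 \<le> d T S g" unfolding d_eq by (rule dyadic_sum_nonneg[OF d_terms])
  have "d T S g \<le> 2 * 2" unfolding d_eq by (rule dyadic_sum_le[OF d_terms])
  then show "d T S g \<le> 4" by simp
qed

section \<open>Correlation distances at a single group element\<close>

definition corr_diff :: "('g \<Rightarrow> 'a \<Rightarrow> 'a) \<Rightarrow> ('g \<Rightarrow> 'a \<Rightarrow> 'a) \<Rightarrow> 'g \<Rightarrow> nat \<Rightarrow> nat \<Rightarrow> real" where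
  "corr_diff T S g i j = \<bar>measure M (img T g (A i) \<inter> A j) - measure M (img S g (A i) \<inter> A j)\<bar>"

lemma corr_diff_nonneg: "0 \<le> corr_diff T S g i j" and corr_diff_le: "corr_diff T S g i j \<le> 1"
proof -
  have "\<bar>measure M B - measure M C\<bar> \<le> 1" for B C
    using prob_le_1[of B] prob_le_1[of C] measure_nonneg[of M B] measure_nonneg[of M C] by linarith
  then show "corr_diff T S g i j \<le> 1" by (simp add: corr_diff_def)
qed (simp add: corr_diff_def)

lemma corr_sum_nonneg: "0 \<le> dyadic_sum (corr_diff T S g i)" and corr_sum_le: "dyadic_sum (corr_diff T S g i) \<le> 2"
proof -
  show "0 \<le> dyadic_sum (corr_diff T S g i)" by (rule dyadic_sum_nonneg[OF corr_diff_nonneg corr_diff_le])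
  have "dyadic_sum (corr_diff T S g i) \<le> 2 * 1" by (rule dyadic_sum_le[OF corr_diff_nonneg corr_diff_le])
  then show "dyadic_sum (corr_diff T S g i) \<le> 2" by simp
qed

lemma a_eq: "a T S g = dyadic_sum (\<lambda>i. dyadic_sum (corr_diff T S g i))"
proof -
  have "(\<Sum>j. (1/2) ^ (i + j) * corr_diff T S g i j) = (1/2) ^ i * dyadic_sum (corr_diff T S g i)" for i
  proof -
    have "(\<Sum>j. (1/2) ^ i * ((1/2) ^ j * corr_diff T S g i j)) = (1/2) ^ i * dyadic_sum (corr_diff T S g i)"
      unfolding dyadic_sum_def by (rule suminf_mult[OF dyadic_summable[OF corr_diff_nonneg corr_diff_le]])
    then show ?thesis by (simp add: power_add mult.assoc)
  qed
  then show ?thesis by (simp add: dist_a_def dyadic_sum_def[of "\<lambda>i. dyadic_sum (_ i)"] corr_diff_def)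
qed

lemma a_nonneg: "0 \<le> a T S g" and a_le: "a T S g \<le> 4"
proof -
  show "0 \<le> a T S g" unfolding a_eq by (rule dyadic_sum_nonneg[OF corr_sum_nonneg corr_sum_le])
  have "a T S g \<le> 2 * 2" unfolding a_eq by (rule dyadic_sum_le[OF corr_sum_nonneg corr_sum_le])
  then show "a T S g \<le> 4" by simp
qed

lemma corr_diff_le_a: "corr_diff T S g i j \<le> 2 ^ (i + j) * a T S g"
proof -
  have "corr_diff T S g i j \<le> 2 ^ j * dyadic_sum (corr_diff T S g i)"
    by (rule dyadic_sum_term[OF corr_diff_nonneg corr_diff_le])
  also have "\<dots> \<le> 2 ^ j * (2 ^ i * a T S g)"
    unfolding a_eq
    using dyadic_sum_term[OF corr_sum_nonneg corr_sum_le] by (intro mult_left_mono) auto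
  finally show ?thesis by (simp add: power_add mult_ac)
qed

lemma bdd_d: "bdd_above ((\<lambda>g. d T S g) ` Z)" and bdd_a: "bdd_above ((\<lambda>g. a T S g) ` Z)"
  using d_le a_le by (auto intro!: bdd_aboveI)

lemma d_le_sup_d: "i \<in> I \<Longrightarrow> g \<in> K i \<Longrightarrow> d T S g \<le> sup_d T S i"
  unfolding sup_d_def using cSUP_upper[OF _ bdd_d] by simp

lemma a_le_sup_a: "g \<in> \<Gamma> \<Longrightarrow> a T S g \<le> sup_a T S"
  unfolding sup_a_def using cSUP_upper[OF _ bdd_a] by simp

lemma sup_d_least:
  "(\<And>g. g \<in> K i \<Longrightarrow> i \<in> I \<Longrightarrow> d T S g \<le> c) \<Longrightarrow> 0 \<le> c \<Longrightarrow> sup_d T S i \<le> c"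
  unfolding sup_d_def using K_nonempty by (auto intro!: cSUP_least)

lemma sup_a_least: "(\<And>g. g \<in> \<Gamma> \<Longrightarrow> a T S g \<le> c) \<Longrightarrow> sup_a T S \<le> c"
  unfolding sup_a_def using \<Gamma>_nonempty by (auto intro!: cSUP_least)

lemma sup_d_nonneg: "0 \<le> sup_d T S i"
proof (cases "i \<in> I")
  case True
  then obtain g where "g \<in> K i" using K_nonempty by blast
  then show ?thesis using d_le_sup_d[OF True] d_nonneg order_trans by blast
qed (simp add: sup_d_def)

lemma sup_d_le: "sup_d T S i \<le> 4"
  by (rule sup_d_least) (auto intro: d_le)

lemma sup_a_nonneg: "0 \<le> sup_a T S"
  using \<Gamma>_nonempty a_nonneg a_le_sup_a order_trans by blast

lemma d_le_m:
  assumes "i \<in> I" "g \<in> K i"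
  shows "d T S g \<le> 2 ^ i * m T S"
proof -
  have "d T S g \<le> 2 ^ i * dyadic_sum (sup_d T S)"
    by (rule order_trans[OF d_le_sup_d[OF assms] dyadic_sum_term[where b = "sup_d T S", OF sup_d_nonneg sup_d_le]])
  also have "\<dots> \<le> 2 ^ i * m T S" using sup_a_nonneg by (intro mult_left_mono) (auto simp: m_eq)
  finally show ?thesis .
qed

lemma dyadic_sup_d_nonneg: "0 \<le> dyadic_sum (sup_d T S)"
  by (rule dyadic_sum_nonneg[OF sup_d_nonneg sup_d_le])

lemma a_le_m: "g \<in> \<Gamma> \<Longrightarrow> a T S g \<le> m T S"
  using a_le_sup_a[of g T S] dyadic_sup_d_nonneg[of T S] by (simp add: m_eq)

text \<open>A preimage under \<open>T g\<close> is an image under \<open>T (- g)\<close> up to a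
  null set, so d at g bounds the images at both g and -g. This is why the Cauchy argument can work
  with a set of g stable under negation.\<close>

lemma d_eq_img:
  assumes T: "alg_action M T" and S: "alg_action M S"
  shows "d T S g = dyadic_sum (\<lambda>i. sdist M (img T g (A i)) (img S g (A i)) +
    sdist M (img T (- g) (A i)) (img S (- g) (A i)))"
proof -
  have "sdist M (mpt_preimg M (T g) (A i)) (mpt_preimg M (S g) (A i)) =
      sdist M (img T (- g) (A i)) (img S (- g) (A i))" for i
    using T S by (intro sdist_cong_0 sdist_action_preimg_img prob_space_axioms mpt_preimg_sets action_mp
        action_img_sets) auto
  then show ?thesis by (simp add: d_eq)
qed

lemma sdist_img_le_d:
  assumes T: "alg_action M T" and S: "alg_action M S"
  shows "sdist M (img T g (A i)) (img S g (A i)) \<le> 2 ^ i * d T S g"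
    and "sdist M (img T (- g) (A i)) (img S (- g) (A i)) \<le> 2 ^ i * d T S g"
proof -
  have "sdist M (img T g (A i)) (img S g (A i)) + sdist M (img T (- g) (A i)) (img S (- g) (A i))
      \<le> 2 ^ i * d T S g"
    unfolding d_eq_img[OF assms] by (rule dyadic_sum_term[OF d_terms])
  then show "sdist M (img T g (A i)) (img S g (A i)) \<le> 2 ^ i * d T S g"
    "sdist M (img T (- g) (A i)) (img S (- g) (A i)) \<le> 2 ^ i * d T S g"
    using sdist_nonneg[of M "img T g (A i)" "img S g (A i)"]
      sdist_nonneg[of M "img T (- g) (A i)" "img S (- g) (A i)"] by linarith+
qed

text \<open>Both maps are isometries, so moving from B to C costs the same distance once on each
  side, independently of g.\<close>

lemma sdist_img_approx:
  assumes T: "alg_action M T" and S: "alg_action M S" and B: "B \<in> sets M" "C \<in> sets M"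
  shows "sdist M (img T g B) (img S g B) \<le> 2 * sdist M B C + sdist M (img T g C) (img S g C)"
  using sdist_triangle[OF action_img_sets[OF T B(1)] action_img_sets[OF T B(2)] action_img_sets[OF S B(1)], of g g g]
    sdist_triangle[OF action_img_sets[OF T B(2)] action_img_sets[OF S B(2)] action_img_sets[OF S B(1)], of g g g]
    sdist_action_img[OF T B, of g] sdist_action_img[OF S B(2,1), of g] sdist_commute[of M B C]
  by linarith

section \<open>The pseudometric axioms and distance zero\<close>

lemma d_triangle:
  assumes T: "alg_action M T" and S: "alg_action M S" and R: "alg_action M R"
  shows "d T R g \<le> d T S g + d S R g"
  unfolding d_eq_img[OF T S] d_eq_img[OF S R] d_eq_img[OF T R]
proof (rule dyadic_sum_triangle[OF d_terms(1) d_terms(1) d_terms(1) d_terms(2) d_terms(2)])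
  fix i
  have "sdist M (img T h (A i)) (img R h (A i)) \<le>
      sdist M (img T h (A i)) (img S h (A i)) + sdist M (img S h (A i)) (img R h (A i))" for h
    using T S R by (intro sdist_triangle action_img_sets) auto
  from this[of g] this[of "- g"]
  show "sdist M (img T g (A i)) (img R g (A i)) + sdist M (img T (- g) (A i)) (img R (- g) (A i)) \<le>
      sdist M (img T g (A i)) (img S g (A i)) + sdist M (img T (- g) (A i)) (img S (- g) (A i)) +
      (sdist M (img S g (A i)) (img R g (A i)) + sdist M (img S (- g) (A i)) (img R (- g) (A i)))"
    by linarith
qed

lemma a_triangle: "a T R g \<le> a T S g + a S R g"
proof -
  have "dyadic_sum (corr_diff T R g i) \<le> dyadic_sum (corr_diff T S g i) + dyadic_sum (corr_diff S R g i)" for i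
    by (rule dyadic_sum_triangle[OF corr_diff_nonneg corr_diff_nonneg corr_diff_nonneg corr_diff_le corr_diff_le])
      (simp add: corr_diff_def)
  then show ?thesis
    unfolding a_eq
    by (rule dyadic_sum_triangle[OF corr_sum_nonneg corr_sum_nonneg corr_sum_nonneg corr_sum_le corr_sum_le])
qed

lemma m_commute: "m T S = m S T"
proof -
  have "d T S g = d S T g" for g by (simp add: d_eq sdist_commute)
  moreover have "corr_diff T S g = corr_diff S T g" for g
    by (simp add: corr_diff_def fun_eq_iff abs_minus_commute)
  then have "a T S g = a S T g" for g by (simp add: a_eq)
  ultimately have "sup_a T S = sup_a S T" "sup_d T S i = sup_d S T i" for i
    by (cases "i \<in> I"; simp add: sup_a_def sup_d_def)+
  then show ?thesis by (simp add: m_eq dyadic_sum_def)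
qed

lemma m_triangle:
  assumes "alg_action M T" "alg_action M S" "alg_action M R"
  shows "m T R \<le> m T S + m S R"
proof -
  have "dyadic_sum (sup_d T R) \<le> dyadic_sum (sup_d T S) + dyadic_sum (sup_d S R)"
  proof (rule dyadic_sum_triangle[OF sup_d_nonneg sup_d_nonneg sup_d_nonneg sup_d_le sup_d_le])
    fix i
    show "sup_d T R i \<le> sup_d T S i + sup_d S R i"
    proof (rule sup_d_least)
      fix g assume "g \<in> K i" "i \<in> I"
      then show "d T R g \<le> sup_d T S i + sup_d S R i"
        using d_triangle[OF assms, where g = g] d_le_sup_d[of i g T S] d_le_sup_d[of i g S R] by linarith
    qed (simp add: sup_d_nonneg)
  qed
  moreover have "sup_a T R \<le> sup_a T S + sup_a S R"
  proof (rule sup_a_least)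
    fix g assume "g \<in> \<Gamma>"
    then show "a T R g \<le> sup_a T S + sup_a S R"
      using a_triangle[where T=T and R=R and g=g and S=S] a_le_sup_a[of g T S] a_le_sup_a[of g S R] by linarith
  qed
  ultimately show ?thesis by (simp add: m_eq)
qed

lemma equiv_iff_sdist_img:
  assumes T: "alg_action M T" and S: "alg_action M S"
  shows "(AE x in M. T g x = S g x) \<longleftrightarrow> (\<forall>B\<in>sets M. sdist M (img T (- g) B) (img S (- g) B) = 0)"
proof -
  have eq: "sdist M (img T (- g) B) (img S (- g) B) = sdist M (mpt_preimg M (T g) B) (mpt_preimg M (S g) B)"
    if "B \<in> sets M" for B
    using T S that by (intro sdist_cong_0[symmetric] sdist_action_preimg_img prob_space_axioms mpt_preimg_sets action_mp
        action_img_sets) auto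
  show ?thesis
  proof
    assume "AE x in M. T g x = S g x"
    then show "\<forall>B\<in>sets M. sdist M (img T (- g) B) (img S (- g) B) = 0"
      using sdist_mpt_preimg_AE[OF action_mp[OF T] action_mp[OF S]] by (simp add: eq)
  next
    assume "\<forall>B\<in>sets M. sdist M (img T (- g) B) (img S (- g) B) = 0"
    then show "AE x in M. T g x = S g x"
      by (intro AE_eq_of_preimages[OF coordinate] action_mp[OF T] action_mp[OF S]) (simp add: eq)
  qed
qed

text \<open>Distance zero forces equality of the maps directly only for g in the \<open>K i\<close>;
  the g along which two actions agree form a subgroup, and \<open>generating\<close> does the
  rest.\<close>

lemma m_eq_0_imp_equiv:
  assumes T: "alg_action M T" and S: "alg_action M S" and m0: "m T S = 0"
  shows "action_equiv M T S"
proof -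
  define H where "H = {g. AE x in M. T g x = S g x}"
  have "is_subgroup H"
    unfolding is_subgroup_def
  proof (intro conjI ballI)
    have "AE x in M. T 0 x = S 0 x" using action_0[OF T] action_0[OF S] by eventually_elim simp
    then show "0 \<in> H" by (simp add: H_def)
  next
    fix g h assume "g \<in> H" "h \<in> H"
    then have g: "AE x in M. T g x = S g x" and h: "AE x in M. T h x = S h x" by (auto simp: H_def)
    have "AE x in M. T (g + h) x = S (g + h) x"
      using h measure_preserving_map_AE[OF action_mp[OF S, of h] g] action_add[OF T, of g h] action_add[OF S, of g h]
      by eventually_elim metis
    then show "g + h \<in> H" by (simp add: H_def)
  next
    fix g assume "g \<in> H"
    then have g: "AE x in M. T g x = S g x" by (simp add: H_def)
    have "AE x in M. S (- g) (T g x) = x"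
      using g action_add[OF S, of "- g" g] action_0[OF S] by eventually_elim simp
    from mpt_inv_AE_unique[OF action_invertible[OF T] action_mp[OF S] this] action_inv[OF T, of g]
    have "AE x in M. T (- g) x = S (- g) x" by eventually_elim metis
    then show "- g \<in> H" by (simp add: H_def)
  qed
  moreover have "(\<Union>i\<in>I. K i) \<subseteq> H"
  proof
    fix g assume "g \<in> (\<Union>i\<in>I. K i)"
    then obtain i where "i \<in> I" "g \<in> K i" by blast
    then have "d T S g \<le> 0" using d_le_m[of i g T S] m0 by simp
    then have zero: "sdist M (img T (- g) (A k)) (img S (- g) (A k)) = 0" for k
      using sdist_img_le_d(2)[OF T S, of g k] d_nonneg[where T = T and S = S and g = g]
      by (simp add: antisym)
    have "sdist M (img T (- g) B) (img S (- g) B) = 0" if B: "B \<in> sets M" for B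
    proof (rule antisym)
      show "sdist M (img T (- g) B) (img S (- g) B) \<le> 0"
      proof (rule field_le_epsilon)
        fix e :: real assume "0 < e"
        then obtain k where "sdist M B (A k) < e / 2" using dense_A[OF B, of "e / 2"] by auto
        then show "sdist M (img T (- g) B) (img S (- g) B) \<le> 0 + e"
          using sdist_img_approx[OF T S B sets_A[of k], where g = "- g"] zero[of k] by simp
      qed
    qed simp
    then show "g \<in> H" using equiv_iff_sdist_img[OF T S] by (simp add: H_def)
  qed
  ultimately have "H = UNIV" by (intro generating)
  then show ?thesis by (auto simp: action_equiv_def H_def)
qed

lemma equiv_imp_m_eq_0:
  assumes T: "alg_action M T" and S: "alg_action M S" and eq: "action_equiv M T S"
  shows "m T S = 0"
proof -
  have zero: "sdist M (img T g B) (img S g B) = 0" if "B \<in> sets M" for g B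
    using equiv_iff_sdist_img[OF T S, of "- g"] eq that by (simp add: action_equiv_def)
  have "d T S g = 0" for g unfolding d_eq_img[OF T S] by (simp add: zero dyadic_sum_def)
  moreover have "corr_diff T S g i j = 0" for g i j
    using measure_Int_diff_le_sdist(1)[OF action_img_sets[OF T sets_A[of i]] action_img_sets[OF S sets_A[of i]] sets_A[of j], of g g]
      zero[OF sets_A[of i], of g]
    by (simp add: corr_diff_def)
  then have "corr_diff T S g i = (\<lambda>_. 0)" for g i by blast
  then have "a T S g = 0" for g by (simp add: a_eq dyadic_sum_def)
  ultimately have "sup_a T S = 0" "sup_d T S i = 0" for i
    using K_nonempty[of i] \<Gamma>_nonempty by (cases "i \<in> I"; simp add: sup_d_def sup_a_def)+
  then show ?thesis by (simp add: m_eq dyadic_sum_def)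
qed

end

subsection \<open>Completeness\<close>

context mixing_space
begin

lemma mixing_is_action: "T \<in> mixing_actions M \<Gamma> \<Longrightarrow> is_action M T"
  by (simp add: mixing_actions_def)

lemma mixing_alg_action: "T \<in> mixing_actions M \<Gamma> \<Longrightarrow> alg_action M T"
  by (simp add: mixing_actions_def is_action_iff)

text \<open>Quantified over all measurable sets, not only the \<open>A k\<close>: the product step
  applies it to an image of B, which need not belong to the family.\<close>

definition img_cauchy :: "(nat \<Rightarrow> 'g \<Rightarrow> 'a \<Rightarrow> 'a) \<Rightarrow> 'g \<Rightarrow> bool" where
  "img_cauchy X g \<longleftrightarrow> (\<forall>B\<in>sets M. \<forall>e>0. \<exists>N. \<forall>p\<ge>N. \<forall>n\<ge>N. sdist M (img (X p) g B) (img (X n) g B) < e)"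

lemma img_cauchyD:
  assumes "img_cauchy X g" "B \<in> sets M" "e > 0"
  obtains N where "\<And>p n. p \<ge> N \<Longrightarrow> n \<ge> N \<Longrightarrow> sdist M (img (X p) g B) (img (X n) g B) < e"
  using assms unfolding img_cauchy_def by meson

lemma img_cauchy_of_dense:
  assumes X: "\<And>n. alg_action M (X n)"
    and "\<And>k e. e > 0 \<Longrightarrow> \<exists>N. \<forall>p\<ge>N. \<forall>n\<ge>N. sdist M (img (X p) g (A k)) (img (X n) g (A k)) < e"
  shows "img_cauchy X g"
  unfolding img_cauchy_def
proof (intro ballI allI impI)
  fix B and e :: real assume B: "B \<in> sets M" and e: "e > 0"
  obtain k where k: "sdist M B (A k) < e / 4" using dense_A[OF B, of "e / 4"] e by auto
  obtain N where N: "\<And>p n. p \<ge> N \<Longrightarrow> n \<ge> N \<Longrightarrow> sdist M (img (X p) g (A k)) (img (X n) g (A k)) < e / 2"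
    using assms(2)[of "e / 2" k] e by auto
  have "sdist M (img (X p) g B) (img (X n) g B) < e" if "p \<ge> N" "n \<ge> N" for p n
    using sdist_img_approx[OF X[of p] X[of n] B sets_A[of k], where g = g] k N[OF that] by linarith
  then show "\<exists>N. \<forall>p\<ge>N. \<forall>n\<ge>N. sdist M (img (X p) g B) (img (X n) g B) < e" by blast
qed

lemma img_cauchy_0:
  assumes X: "\<And>n. alg_action M (X n)"
  shows "img_cauchy X 0"
proof -
  have "sdist M (img (X p) 0 B) (img (X n) 0 B) = sdist M B B" if "B \<in> sets M" for B p n
    using that X by (intro sdist_cong_0 sdist_action_img_0 prob_space_axioms action_img_sets) auto
  then show ?thesis by (simp add: img_cauchy_def)
qed

text \<open>The inner image under \<open>X q\<close> at h moves with q. It is frozen at q = N1 as a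
  fixed set C; the outer map is an isometry, so the replacement costs less than e/4 uniformly in q,
  and the Cauchy property at g is needed for C alone.\<close>

lemma img_cauchy_add:
  assumes X: "\<And>n. alg_action M (X n)" and g: "img_cauchy X g" and h: "img_cauchy X h"
  shows "img_cauchy X (g + h)"
  unfolding img_cauchy_def
proof (intro ballI allI impI)
  fix B and e :: real assume B: "B \<in> sets M" and e: "e > 0"
  obtain N1 where N1: "\<And>p n. p \<ge> N1 \<Longrightarrow> n \<ge> N1 \<Longrightarrow> sdist M (img (X p) h B) (img (X n) h B) < e / 4"
    using img_cauchyD[OF h B, of "e / 4"] e by auto
  define C where "C = img (X N1) h B"
  have C: "C \<in> sets M" unfolding C_def by (rule action_img_sets[OF X B])
  obtain N2 where N2: "\<And>p n. p \<ge> N2 \<Longrightarrow> n \<ge> N2 \<Longrightarrow> sdist M (img (X p) g C) (img (X n) g C) < e / 4"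
    using img_cauchyD[OF g C, of "e / 4"] e by auto
  have "sdist M (img (X p) (g + h) B) (img (X n) (g + h) B) < e" if p: "p \<ge> max N1 N2" and n: "n \<ge> max N1 N2" for p n
  proof -
    have near: "sdist M (img (X q) (g + h) B) (img (X q) g C) < e / 4" if "q \<ge> N1" for q
    proof -
      have hq: "img (X q) h B \<in> sets M" by (rule action_img_sets[OF X B])
      have "sdist M (img (X q) (g + h) B) (img (X q) g C) = sdist M (img (X q) g (img (X q) h B)) (img (X q) g C)"
        using action_img_sets[OF X] hq B C sdist_action_img_add[OF X prob_space_axioms B, of q g h]
        by (intro sdist_cong_0) auto
      also have "\<dots> = sdist M (img (X q) h B) C" by (rule sdist_action_img[OF X hq C])
      also have "\<dots> < e / 4" unfolding C_def using N1[OF that order_refl] .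
      finally show ?thesis .
    qed
    have "sdist M (img (X p) (g + h) B) (img (X n) (g + h) B) \<le>
        sdist M (img (X p) (g + h) B) (img (X p) g C) + sdist M (img (X p) g C) (img (X n) (g + h) B)"
      by (intro sdist_triangle action_img_sets[OF X] B C)
    moreover have "sdist M (img (X p) g C) (img (X n) (g + h) B) \<le>
        sdist M (img (X p) g C) (img (X n) g C) + sdist M (img (X n) g C) (img (X n) (g + h) B)"
      by (intro sdist_triangle action_img_sets[OF X] B C)
    ultimately show ?thesis
      using near[of p] near[of n] N2[of p n] p n sdist_commute[of M "img (X n) (g + h) B" "img (X n) g C"] e
      by linarith
  qed
  then show "\<exists>N. \<forall>p\<ge>N. \<forall>n\<ge>N. sdist M (img (X p) (g + h) B) (img (X n) (g + h) B) < e" by blast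
qed

lemma img_cauchy_of_m_cauchy:
  assumes X: "\<And>n. alg_action M (X n)"
    and cauchy: "\<And>e. e > 0 \<Longrightarrow> \<exists>N. \<forall>p\<ge>N. \<forall>n\<ge>N. m (X p) (X n) < e"
  shows "img_cauchy X g"
proof -
  define H where "H = {g. img_cauchy X g \<and> img_cauchy X (- g)}"
  have "is_subgroup H"
    unfolding is_subgroup_def
  proof (intro conjI ballI)
    show "0 \<in> H" using img_cauchy_0[of X, OF X] by (simp add: H_def)
    show "- x \<in> H" if "x \<in> H" for x using that by (simp add: H_def)
    show "x + y \<in> H" if "x \<in> H" "y \<in> H" for x y
      using that img_cauchy_add[of X x y, OF X] img_cauchy_add[of X "- y" "- x", OF X]
      unfolding H_def mem_Collect_eq minus_add by blast
  qed
  moreover have "(\<Union>i\<in>I. K i) \<subseteq> H"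
  proof
    fix g assume "g \<in> (\<Union>i\<in>I. K i)"
    then obtain i where i: "i \<in> I" "g \<in> K i" by blast
    have "\<exists>N. \<forall>p\<ge>N. \<forall>n\<ge>N. sdist M (img (X p) g (A k)) (img (X n) g (A k)) < e \<and>
        sdist M (img (X p) (- g) (A k)) (img (X n) (- g) (A k)) < e" if e: "e > 0" for k and e :: real
    proof -
      \<comment> \<open>The two powers undo the weights: 2^i of \<open>K i\<close> in the metric,
        2^k of \<open>A k\<close> inside d.\<close>
      obtain N where N: "\<And>p n. p \<ge> N \<Longrightarrow> n \<ge> N \<Longrightarrow> m (X p) (X n) < e / (2 ^ k * 2 ^ i)"
        using cauchy[of "e / (2 ^ k * 2 ^ i)"] e by auto
      have "2 ^ k * d (X p) (X n) g < e" if "p \<ge> N" "n \<ge> N" for p n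
      proof -
        have "2 ^ k * d (X p) (X n) g \<le> 2 ^ k * (2 ^ i * m (X p) (X n))"
          using d_le_m[OF i, of "X p" "X n"] by (intro mult_left_mono) auto
        also have "\<dots> < e" using N[OF that] by (simp add: field_simps)
        finally show ?thesis .
      qed
      then show ?thesis
        using sdist_img_le_d[OF X X] by (intro exI[of _ N]) (meson le_less_trans)
    qed
    then show "g \<in> H"
      unfolding H_def mem_Collect_eq
      by (intro conjI img_cauchy_of_dense[OF X]) meson+
  qed
  ultimately have "H = UNIV" by (intro generating)
  then show ?thesis by (auto simp: H_def)
qed

text \<open>Limits are chosen for each g independently, so no algebraic relation is built in; the
  group law is recovered because preimages determine a map almost everywhere.\<close>

lemma alg_action_limit:
  assumes X: "\<And>n. alg_action M (X n)" and cauchy: "\<And>g. img_cauchy X g"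
  shows "\<exists>V. alg_action M V \<and> (\<forall>g. \<forall>B\<in>sets M. (\<lambda>n. sdist M (img (X n) g B) (img V g B)) \<longlonglongrightarrow> 0)"
proof -
  have pre_img: "sdist M (mpt_preimg M (X n g) B) (img (X n) (- g) B) = 0" if "B \<in> sets M" for n g B
    by (rule sdist_action_preimg_img[OF X prob_space_axioms that])
  note pre_sets = mpt_preimg_sets[OF action_mp[OF X]]
  have "\<exists>V. measure_preserving_map M V \<and>
      (\<forall>B\<in>sets M. (\<lambda>n. sdist M (mpt_preimg M (X n g) B) (mpt_preimg M V B)) \<longlonglongrightarrow> 0)" for g
  proof (rule measure_preserving_limit[OF coordinate])
    show "measure_preserving_map M (X n g)" for n by (rule action_mp[OF X])
    fix B and e :: real assume B: "B \<in> sets M" and e: "e > 0"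
    have "sdist M (mpt_preimg M (X p g) B) (mpt_preimg M (X n g) B) =
        sdist M (img (X p) (- g) B) (img (X n) (- g) B)" for p n
      by (rule sdist_cong_0[OF pre_sets[OF B] pre_sets[OF B] action_img_sets[OF X B] action_img_sets[OF X B]
          pre_img[OF B] pre_img[OF B]])
    then show "\<exists>N. \<forall>p\<ge>N. \<forall>n\<ge>N. sdist M (mpt_preimg M (X p g) B) (mpt_preimg M (X n g) B) < e"
      using cauchy[of "- g"] B e by (simp add: img_cauchy_def)
  qed
  then obtain V where V: "\<And>g. measure_preserving_map M (V g)"
    and lim: "\<And>g B. B \<in> sets M \<Longrightarrow> (\<lambda>n. sdist M (mpt_preimg M (X n g) B) (mpt_preimg M (V g) B)) \<longlonglongrightarrow> 0"
    by metis
  note V_sets = mpt_preimg_sets[OF V]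
  have add: "AE x in M. V g (V h x) = V (g + h) x" for g h
  proof (rule AE_eq_of_preimages[OF coordinate measure_preserving_map_comp[OF V V] V])
    fix B assume B: "B \<in> sets M"
    \<comment> \<open>The summands are the errors of a chain that replaces \<open>V h\<close> by
      \<open>X n h\<close>, then \<open>V g\<close> by \<open>X n g\<close> inside the isometry
      \<open>X n h\<close>, then uses the group law of \<open>X n\<close> at no cost, and finally
      returns from \<open>X n (g + h)\<close> to \<open>V (g + h)\<close>.\<close>
    let ?u = "\<lambda>n. sdist M (mpt_preimg M (X n h) (mpt_preimg M (V g) B)) (mpt_preimg M (V h) (mpt_preimg M (V g) B))
      + sdist M (mpt_preimg M (X n g) B) (mpt_preimg M (V g) B)
      + sdist M (mpt_preimg M (X n (g + h)) B) (mpt_preimg M (V (g + h)) B)"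
    have u: "?u \<longlonglongrightarrow> 0 + 0 + 0" using B V_sets by (intro tendsto_add lim) auto
    have "sdist M (mpt_preimg M (V h) (mpt_preimg M (V g) B)) (mpt_preimg M (V (g + h)) B) \<le> ?u n" for n
    proof -
      have "sdist M (mpt_preimg M (X n h) (mpt_preimg M (X n g) B)) (mpt_preimg M (X n (g + h)) B) = 0"
        unfolding mpt_preimg_comp[OF action_mp[OF X]]
        by (rule sdist_mpt_preimg_AE[OF measure_preserving_map_comp[OF action_mp[OF X] action_mp[OF X]]
              action_mp[OF X] B action_add[OF X]])
      moreover have "sdist M (mpt_preimg M (X n h) (mpt_preimg M (V g) B)) (mpt_preimg M (X n h) (mpt_preimg M (X n g) B))
          = sdist M (mpt_preimg M (V g) B) (mpt_preimg M (X n g) B)"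
        by (rule sdist_mpt_preimg[OF action_mp[OF X] V_sets[OF B] pre_sets[OF B]])
      moreover have "sdist M (mpt_preimg M (V h) (mpt_preimg M (V g) B)) (mpt_preimg M (V (g + h)) B) \<le>
          sdist M (mpt_preimg M (V h) (mpt_preimg M (V g) B)) (mpt_preimg M (X n h) (mpt_preimg M (V g) B)) +
          sdist M (mpt_preimg M (X n h) (mpt_preimg M (V g) B)) (mpt_preimg M (V (g + h)) B)"
        by (intro sdist_triangle V_sets pre_sets B)
      moreover have "sdist M (mpt_preimg M (X n h) (mpt_preimg M (V g) B)) (mpt_preimg M (V (g + h)) B) \<le>
          sdist M (mpt_preimg M (X n h) (mpt_preimg M (V g) B)) (mpt_preimg M (X n h) (mpt_preimg M (X n g) B)) +
          sdist M (mpt_preimg M (X n h) (mpt_preimg M (X n g) B)) (mpt_preimg M (V (g + h)) B)"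
        by (intro sdist_triangle V_sets pre_sets B)
      moreover have "sdist M (mpt_preimg M (X n h) (mpt_preimg M (X n g) B)) (mpt_preimg M (V (g + h)) B) \<le>
          sdist M (mpt_preimg M (X n h) (mpt_preimg M (X n g) B)) (mpt_preimg M (X n (g + h)) B) +
          sdist M (mpt_preimg M (X n (g + h)) B) (mpt_preimg M (V (g + h)) B)"
        by (intro sdist_triangle V_sets pre_sets B)
      ultimately show ?thesis by (simp add: sdist_commute)
    qed
    then have "sdist M (mpt_preimg M (V h) (mpt_preimg M (V g) B)) (mpt_preimg M (V (g + h)) B) \<le> 0 + 0 + 0"
      by (intro LIMSEQ_le_const[OF u]) auto
    then show "sdist M (mpt_preimg M (\<lambda>x. V g (V h x)) B) (mpt_preimg M (V (g + h)) B) = 0"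
      unfolding mpt_preimg_comp[OF V] by (simp add: antisym)
  qed
  have zero: "AE x in M. V 0 x = x"
  proof (rule AE_eq_of_preimages[OF coordinate V measure_preserving_map_id])
    fix B assume B: "B \<in> sets M"
    have "sdist M (mpt_preimg M (X n 0) B) (mpt_preimg M (V 0) B) =
        sdist M (mpt_preimg M (\<lambda>x. x) B) (mpt_preimg M (V 0) B)" for n
      using sdist_mpt_preimg_AE[OF action_mp[OF X] measure_preserving_map_id B action_0[OF X]]
      by (intro sdist_cong_0 pre_sets V_sets mpt_preimg_sets[OF measure_preserving_map_id] B) auto
    then show "sdist M (mpt_preimg M (V 0) B) (mpt_preimg M (\<lambda>x. x) B) = 0"
      using lim[OF B, of 0] by (simp add: LIMSEQ_const_iff sdist_commute)
  qed
  have inv: "AE x in M. V (- g) (V g x) = x" for g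
    using add[of "- g" g] zero by eventually_elim simp
  have "invertible_mpt M (V g)" for g
    unfolding invertible_mpt_def using V inv[of g] inv[of "- g"] by auto
  then have act: "alg_action M V" using add by (simp add: alg_action_def)
  moreover have "(\<lambda>n. sdist M (img (X n) g B) (img V g B)) \<longlonglongrightarrow> 0" if B: "B \<in> sets M" for g B
  proof -
    have "sdist M (mpt_preimg M (X n (- g)) B) (mpt_preimg M (V (- g)) B) = sdist M (img (X n) g B) (img V g B)" for n
      using sdist_cong_0[OF pre_sets[OF B] V_sets[OF B] action_img_sets[OF X B] action_img_sets[OF act B]
          pre_img[OF B] sdist_action_preimg_img[OF act prob_space_axioms B], of n "- g" "- g"] by simp
    then show ?thesis using lim[OF B, of "- g"] by simp
  qed
  ultimately show ?thesis by blast
qed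

section \<open>Uniformity of the convergence and properties of the limit action\<close>

context
  fixes X V
  assumes X: "\<And>n. X n \<in> mixing_actions M \<Gamma>"
    and cauchy: "\<And>e. e > 0 \<Longrightarrow> \<exists>N. \<forall>p\<ge>N. \<forall>n\<ge>N. m (X p) (X n) < e"
    and V: "alg_action M V"
    and lim: "\<And>g B. B \<in> sets M \<Longrightarrow> (\<lambda>n. sdist M (img (X n) g B) (img V g B)) \<longlonglongrightarrow> 0"
begin

lemma d_tendsto: "(\<lambda>n. d (X n) V g) \<longlonglongrightarrow> 0"
proof -
  have "(\<lambda>n. sdist M (img (X n) g (A i)) (img V g (A i)) + sdist M (img (X n) (- g) (A i)) (img V (- g) (A i)))
      \<longlonglongrightarrow> 0" for i
    using tendsto_add[OF lim[OF sets_A[of i], of g] lim[OF sets_A[of i], of "- g"]] by simp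
  then show ?thesis
    unfolding d_eq_img[OF mixing_alg_action[OF X] V] by (rule dyadic_sum_tendsto_0[OF d_terms])
qed

lemma a_tendsto: "(\<lambda>n. a (X n) V g) \<longlonglongrightarrow> 0"
proof -
  have "(\<lambda>n. corr_diff (X n) V g i j) \<longlonglongrightarrow> 0" for i j
  proof (rule tendsto_sandwich[OF _ _ tendsto_const lim[OF sets_A[of i], of g]])
    show "eventually (\<lambda>n. 0 \<le> corr_diff (X n) V g i j) sequentially" by (simp add: corr_diff_nonneg)
    have "corr_diff (X n) V g i j \<le> sdist M (img (X n) g (A i)) (img V g (A i))" for n
      unfolding corr_diff_def
      by (rule measure_Int_diff_le_sdist(1)[OF action_img_sets[OF mixing_alg_action[OF X] sets_A]
            action_img_sets[OF V sets_A] sets_A])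
    then show "eventually (\<lambda>n. corr_diff (X n) V g i j \<le> sdist M (img (X n) g (A i)) (img V g (A i))) sequentially"
      by simp
  qed
  then have "(\<lambda>n. dyadic_sum (corr_diff (X n) V g i)) \<longlonglongrightarrow> 0" for i
    by (intro dyadic_sum_tendsto_0[OF corr_diff_nonneg corr_diff_le])
  then show ?thesis
    unfolding a_eq by (rule dyadic_sum_tendsto_0[OF corr_sum_nonneg corr_sum_le])
qed

lemma d_uniform:
  assumes i: "i \<in> I" and e: "e > 0"
  shows "\<exists>N. \<forall>n\<ge>N. \<forall>g\<in>K i. d (X n) V g \<le> e"
proof -
  obtain N where N: "\<And>p n. p \<ge> N \<Longrightarrow> n \<ge> N \<Longrightarrow> m (X p) (X n) < e / 2 ^ i"
    using cauchy[of "e / 2 ^ i"] e by auto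
  have "d (X n) V g \<le> e" if n: "n \<ge> N" and g: "g \<in> K i" for n g
  proof -
    \<comment> \<open>Let p tend to infinity in the triangle inequality through \<open>X p\<close>:
      the Cauchy bound is uniform on \<open>K i\<close>, and the pointwise remainder
      disappears.\<close>
    have "(\<lambda>p. e + d (X p) V g) \<longlonglongrightarrow> e + 0" by (intro tendsto_intros d_tendsto)
    moreover have "d (X n) V g \<le> e + d (X p) V g" if p: "p \<ge> N" for p
    proof -
      have "d (X n) (X p) g \<le> 2 ^ i * m (X n) (X p)" by (rule d_le_m[OF i g])
      also have "\<dots> \<le> e" using N[OF n p] by (simp add: field_simps)
      finally show ?thesis
        using d_triangle[OF mixing_alg_action[OF X[of n]] mixing_alg_action[OF X[of p]] V, where g = g] by linarith
    qed
    ultimately have "d (X n) V g \<le> e + 0" by (intro LIMSEQ_le_const) auto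
    then show ?thesis by simp
  qed
  then show ?thesis by blast
qed

lemma a_uniform:
  assumes e: "e > 0"
  shows "\<exists>N. \<forall>n\<ge>N. \<forall>g\<in>\<Gamma>. a (X n) V g \<le> e"
proof -
  obtain N where N: "\<And>p n. p \<ge> N \<Longrightarrow> n \<ge> N \<Longrightarrow> m (X p) (X n) < e" using cauchy[OF e] by auto
  have "a (X n) V g \<le> e" if n: "n \<ge> N" and g: "g \<in> \<Gamma>" for n g
  proof -
    have "(\<lambda>p. e + a (X p) V g) \<longlonglongrightarrow> e + 0" by (intro tendsto_intros a_tendsto)
    moreover have "a (X n) V g \<le> e + a (X p) V g" if p: "p \<ge> N" for p
      using a_le_m[OF g, of "X n" "X p"] N[OF n p] a_triangle[of "X n" g V "X p"] by linarith
    ultimately have "a (X n) V g \<le> e + 0" by (intro LIMSEQ_le_const) auto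
    then show ?thesis by simp
  qed
  then show ?thesis by blast
qed

lemma limit_continuous_on_K:
  assumes i: "i \<in> I" and B: "B \<in> sets M" and C: "C \<in> sets M"
  shows "continuous_on (K i) (\<lambda>g. measure M (img V g B \<inter> C))"
proof (rule uniform_limit_theorem)
  show "eventually (\<lambda>n. continuous_on (K i) (\<lambda>g. measure M (img (X n) g B \<inter> C))) sequentially"
    using continuous_on_subset[OF continuous_on_action[OF mixing_is_action[OF X] B C]] by simp
  show "uniform_limit (K i) (\<lambda>n g. measure M (img (X n) g B \<inter> C)) (\<lambda>g. measure M (img V g B \<inter> C)) sequentially"
    unfolding uniform_limit_sequentially_iff
  proof (intro allI impI)
    fix e :: real assume e: "e > 0"
    obtain k where k: "sdist M B (A k) < e / 4" using dense_A[OF B, of "e / 4"] e by auto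
    obtain N where N: "\<And>n g. n \<ge> N \<Longrightarrow> g \<in> K i \<Longrightarrow> d (X n) V g \<le> e / 2 / 2 ^ k"
      using d_uniform[OF i, of "e / 2 / 2 ^ k"] e by auto
    have "dist (measure M (img (X n) g B \<inter> C)) (measure M (img V g B \<inter> C)) < e" if "n \<ge> N" "g \<in> K i" for n g
    proof -
      note Xn = mixing_alg_action[OF X[of n]]
      have "sdist M (img (X n) g (A k)) (img V g (A k)) \<le> e / 2"
        using sdist_img_le_d(1)[OF Xn V, of g k] N[OF that] by (simp add: field_simps)
      then show ?thesis
        using measure_Int_diff_le_sdist(1)[OF action_img_sets[OF Xn B, of g] action_img_sets[OF V B, of g] C]
          sdist_img_approx[OF Xn V B sets_A[of k], where g = g] k
        unfolding dist_real_def by linarith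
    qed
    then show "\<exists>N. \<forall>n\<ge>N. \<forall>g\<in>K i. dist (measure M (img (X n) g B \<inter> C)) (measure M (img V g B \<inter> C)) < e" by blast
  qed
qed simp

text \<open>Continuity at one interior point of some \<open>K i\<close> propagates to the whole group by translation.\<close>

lemma limit_is_action: "is_action M V"
proof -
  obtain i where i: "i \<in> I" using I_nonempty by blast
  obtain g0 where g0: "g0 \<in> interior (K i)" using interior_K[OF i] by blast
  have "isCont (\<lambda>g. measure M (img V g B \<inter> C)) h" if B: "B \<in> sets M" and C: "C \<in> sets M" for B C h
  proof -
    define s where "s = g0 - h"
    note V_sets = action_img_sets[OF V]
    have sC: "img V s C \<in> sets M" by (rule V_sets[OF C])
    \<comment> \<open>Applying the measure-preserving \<open>V s\<close> to both sets leaves the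
      correlation unchanged, so translating g by s only replaces C by its image; s is chosen to
      carry h to the interior point g0.\<close>
    have eq: "measure M (img V (s + g) B \<inter> img V s C) = measure M (img V g B \<inter> C)" for g
    proof -
      have "measure M (img V (s + g) B \<inter> img V s C) = measure M (img V s (img V g B) \<inter> img V s C)"
        using measure_Int_diff_le_sdist(1)[OF V_sets[OF B] V_sets[OF V_sets[OF B]] sC, of "s + g" s g]
          sdist_action_img_add[OF V prob_space_axioms B, of s g] by simp
      also have "\<dots> = measure M (img V s (img V g B \<inter> C))" by (simp add: action_img_Int[OF V])
      also have "\<dots> = measure M (img V g B \<inter> C)" using V_sets[OF B] C by (intro measure_action_img[OF V]) auto
      finally show ?thesis .
    qed
    have sh: "s + h = g0" by (simp add: s_def)
    have "isCont (\<lambda>g. measure M (img V g B \<inter> img V s C)) g0"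
      using continuous_on_subset[OF limit_continuous_on_K[OF i B sC] interior_subset] g0
      by (simp add: continuous_on_eq_continuous_at)
    moreover have "isCont ((+) s) h"
      using continuous_on_left_translation[OF add_cont, of s] by (simp add: continuous_on_eq_continuous_at)
    ultimately have "isCont (\<lambda>g. measure M (img V (s + g) B \<inter> img V s C)) h"
      using isCont_o2[of h "(+) s" "\<lambda>g. measure M (img V g B \<inter> img V s C)"] by (simp add: sh)
    then show ?thesis by (simp add: eq)
  qed
  then show ?thesis using V by (auto simp: is_action_iff continuous_on_eq_continuous_at)
qed

text \<open>A compact set that works for one sufficiently late \<open>X N\<close> also works for the
  limit, because correlations on \<Gamma> are uniformly close. The error e splits into four
  quarters: \<open>approx\<close> for each of the two actions, \<open>corr_diff\<close> on the
  chosen pair, and mixing of \<open>X N\<close>.\<close>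

lemma limit_mixing: "gamma_mixing M \<Gamma> V"
  unfolding gamma_mixing_def
proof (intro ballI allI impI)
  fix B C and e :: real assume B: "B \<in> sets M" and C: "C \<in> sets M" and e: "e > 0"
  obtain k where k: "sdist M B (A k) < e / 8" using dense_A[OF B, of "e / 8"] e by auto
  obtain l where l: "sdist M C (A l) < e / 8" using dense_A[OF C, of "e / 8"] e by auto
  obtain N where N: "\<And>g. g \<in> \<Gamma> \<Longrightarrow> a (X N) V g \<le> e / 4 / 2 ^ (k + l)"
    using a_uniform[of "e / 4 / 2 ^ (k + l)"] e by auto
  have "\<forall>e>0. \<exists>Q. compact Q \<and>
      (\<forall>g\<in>\<Gamma> - Q. \<bar>measure M (img (X N) g B \<inter> C) - measure M B * measure M C\<bar> < e)"
    using X[of N] B C by (simp add: mixing_actions_def gamma_mixing_def)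
  from this[rule_format, of "e / 4"] obtain Q where Q: "compact Q"
    "\<And>g. g \<in> \<Gamma> - Q \<Longrightarrow> \<bar>measure M (img (X N) g B \<inter> C) - measure M B * measure M C\<bar> < e / 4"
    using e by auto
  have "\<bar>measure M (img V g B \<inter> C) - measure M B * measure M C\<bar> < e" if g: "g \<in> \<Gamma> - Q" for g
  proof -
    have approx: "\<bar>measure M (img T g B \<inter> C) - measure M (img T g (A k) \<inter> A l)\<bar> < e / 4" if T: "alg_action M T" for T
      using measure_Int_diff_le_sdist(1)[OF action_img_sets[OF T B, of g] action_img_sets[OF T sets_A, of g k] C]
        measure_Int_diff_le_sdist(2)[OF C sets_A action_img_sets[OF T sets_A, of g k], of l]
        sdist_action_img[OF T B sets_A[of k], of g] k l by linarith
    have "corr_diff (X N) V g k l \<le> 2 ^ (k + l) * a (X N) V g" by (rule corr_diff_le_a)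
    also have "\<dots> \<le> e / 4" using N[of g] g by (simp add: field_simps)
    finally show ?thesis
      using approx[OF V] approx[OF mixing_alg_action[OF X[of N]]] Q(2)[OF g] unfolding corr_diff_def by linarith
  qed
  then show "\<exists>Q. compact Q \<and> (\<forall>g\<in>\<Gamma> - Q. \<bar>measure M (img V g B \<inter> C) - measure M B * measure M C\<bar> < e)"
    using Q(1) by blast
qed

lemma limit_m_tendsto: "(\<lambda>n. m (X n) V) \<longlonglongrightarrow> 0"
proof -
  have "(\<lambda>n. sup_d (X n) V i) \<longlonglongrightarrow> 0" for i
  proof (rule LIMSEQ_I)
    fix e :: real assume e: "e > 0"
    show "\<exists>N. \<forall>n\<ge>N. norm (sup_d (X n) V i - 0) < e"
    proof (cases "i \<in> I")
      case True
      then obtain N where N: "\<And>n g. n \<ge> N \<Longrightarrow> g \<in> K i \<Longrightarrow> d (X n) V g \<le> e / 2"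
        using d_uniform[OF True, of "e / 2"] e by auto
      have "sup_d (X n) V i \<le> e / 2" if "n \<ge> N" for n
        using N[OF that] e by (intro sup_d_least) auto
      then show ?thesis using e sup_d_nonneg by (intro exI[of _ N]) fastforce
    qed (use e in \<open>simp add: sup_d_def\<close>)
  qed
  then have "(\<lambda>n. dyadic_sum (sup_d (X n) V)) \<longlonglongrightarrow> 0"
    by (rule dyadic_sum_tendsto_0[OF sup_d_nonneg sup_d_le])
  moreover have "(\<lambda>n. sup_a (X n) V) \<longlonglongrightarrow> 0"
  proof (rule LIMSEQ_I)
    fix e :: real assume e: "e > 0"
    obtain N where N: "\<And>n g. n \<ge> N \<Longrightarrow> g \<in> \<Gamma> \<Longrightarrow> a (X n) V g \<le> e / 2"
      using a_uniform[of "e / 2"] e by auto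
    have "sup_a (X n) V \<le> e / 2" if "n \<ge> N" for n
      using N[OF that] by (rule sup_a_least)
    then show "\<exists>N. \<forall>n\<ge>N. norm (sup_a (X n) V - 0) < e"
      using e sup_a_nonneg by (intro exI[of _ N]) fastforce
  qed
  ultimately have "(\<lambda>n. dyadic_sum (sup_d (X n) V) + sup_a (X n) V) \<longlonglongrightarrow> 0 + 0" by (rule tendsto_add)
  then show ?thesis by (simp add: m_eq)
qed

end

lemma m_complete:
  assumes X: "\<And>n. X n \<in> mixing_actions M \<Gamma>"
    and cauchy: "\<And>e. e > 0 \<Longrightarrow> \<exists>N. \<forall>p\<ge>N. \<forall>n\<ge>N. m (X p) (X n) < e"
  shows "\<exists>V\<in>mixing_actions M \<Gamma>. (\<lambda>n. m (X n) V) \<longlonglongrightarrow> 0"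
proof -
  note X_alg = mixing_alg_action[OF X]
  obtain V where V: "alg_action M V"
    "\<And>g B. B \<in> sets M \<Longrightarrow> (\<lambda>n. sdist M (img (X n) g B) (img V g B)) \<longlonglongrightarrow> 0"
    using alg_action_limit[of X, OF X_alg img_cauchy_of_m_cauchy[of X, OF X_alg cauchy]] by blast
  have "V \<in> mixing_actions M \<Gamma>"
    using limit_is_action[of X V, OF X cauchy V] limit_mixing[of X V, OF X cauchy V] by (simp add: mixing_actions_def)
  then show ?thesis using limit_m_tendsto[of X V, OF X cauchy V] by blast
qed

end

subsection \<open>Separability\<close>

context mixing_space
begin

text \<open>A code is a finite list of basic open sets \<open>b l\<close>, each with indices of sets \<open>A k\<close> approximating
  \<open>T\<^sup>g A\<^sub>i\<close> and \<open>T\<^bsup>-g\<^esup> A\<^sub>i\<close> for all \<open>g \<in> b l\<close>; off their union, mixing makes the correlations along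
  \<open>\<Gamma>\<close> almost independent of \<open>T\<close>. Hence actions sharing a code are close.\<close>

definition coded :: "(nat \<Rightarrow> 'g set) \<Rightarrow> nat \<Rightarrow> ('g \<Rightarrow> 'a \<Rightarrow> 'a) \<Rightarrow> (nat \<times> nat list \<times> nat list) list \<Rightarrow> bool" where
  "coded b N T c \<longleftrightarrow>
     (\<forall>(l, ks, ls)\<in>set c. \<forall>g\<in>b l. \<forall>i<N. sdist M (img T g (A i)) (A (ks ! i)) < (1/2) ^ N \<and>
        sdist M (img T (- g) (A i)) (A (ls ! i)) < (1/2) ^ N) \<and>
     (\<forall>i\<in>I. i < N \<longrightarrow> K i \<subseteq> (\<Union>p\<in>set c. b (fst p))) \<and>
     (\<forall>g\<in>\<Gamma> - (\<Union>p\<in>set c. b (fst p)). \<forall>i<N. \<forall>j<N.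
        \<bar>measure M (img T g (A i) \<inter> A j) - measure M (A i) * measure M (A j)\<bar> < (1/2) ^ N)"

lemma coded_exists:
  assumes b_open: "\<And>n. open (b n)" and base: "\<And>W x. open W \<Longrightarrow> x \<in> W \<Longrightarrow> \<exists>n. x \<in> b n \<and> b n \<subseteq> W"
    and T: "T \<in> mixing_actions M \<Gamma>"
  shows "\<exists>c. coded b N T c"
proof -
  define \<delta> :: real where "\<delta> = (1/2) ^ N"
  have \<delta>: "\<delta> > 0" by (simp add: \<delta>_def)
  note act = mixing_is_action[OF T] and alg = mixing_alg_action[OF T]
  have "\<exists>Q. compact Q \<and> (\<forall>g\<in>\<Gamma> - Q. \<bar>measure M (img T g (A i) \<inter> A j) - measure M (A i) * measure M (A j)\<bar> < \<delta>)" for i j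
    using T \<delta> by (simp add: mixing_actions_def gamma_mixing_def)
  then obtain Q where Q: "\<And>i j. compact (Q i j)"
    "\<And>i j g. g \<in> \<Gamma> - Q i j \<Longrightarrow> \<bar>measure M (img T g (A i) \<inter> A j) - measure M (A i) * measure M (A j)\<bar> < \<delta>"
    by metis
  \<comment> \<open>Everything the code must cover: the \<open>K i\<close> that matter at precision
    N, and the exceptional compact sets outside which the correlations are already near
    products.\<close>
  define P where "P = (\<Union>i<N. \<Union>j<N. Q i j) \<union> (\<Union>i\<in>I \<inter> {..<N}. K i)"
  have P: "compact P" unfolding P_def using Q(1) compact_K by (intro compact_Un compact_UN) auto
  define good where "good p \<longleftrightarrow> (\<forall>g\<in>b (fst p). \<forall>i<N. sdist M (img T g (A i)) (A (fst (snd p) ! i)) < \<delta> \<and>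
        sdist M (img T (- g) (A i)) (A (snd (snd p) ! i)) < \<delta>)" for p :: "nat \<times> nat list \<times> nat list"
  have "\<exists>p. g \<in> b (fst p) \<and> good p" for g
  proof -
    obtain k where k: "\<And>i. sdist M (img T g (A i)) (A (k i)) < \<delta>"
      using dense_A[OF action_img_sets[OF alg sets_A] \<delta>] by metis
    obtain l where l: "\<And>i. sdist M (img T (- g) (A i)) (A (l i)) < \<delta>"
      using dense_A[OF action_img_sets[OF alg sets_A] \<delta>] by metis
    \<comment> \<open>Indices found at the single point g remain valid on a neighbourhood, since the
      finitely many distances depend continuously on the group element; W shrinks to a basic set
      there.\<close>
    define W where "W = (\<Inter>i<N. {h. sdist M (img T h (A i)) (A (k i)) < \<delta>} \<inter>
        {h. sdist M (img T (- h) (A i)) (A (l i)) < \<delta>})"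
    have cont: "continuous_on UNIV (\<lambda>h. sdist M (img T h (A i)) (A j))" for i j
      by (rule continuous_on_sdist_action[OF act sets_A sets_A])
    have cont': "continuous_on UNIV (\<lambda>h. sdist M (img T (- h) (A i)) (A j))" for i j
      by (rule continuous_on_compose2[OF cont minus_cont]) auto
    have "open W"
      unfolding W_def using cont cont' by (intro open_INT open_Int open_Collect_less ballI continuous_on_const) auto
    moreover have "g \<in> W" using k l by (simp add: W_def)
    ultimately obtain n where n: "g \<in> b n" "b n \<subseteq> W" using base by blast
    have "good (n, map k [0..<N], map l [0..<N])"
      using n(2) by (auto simp: good_def W_def)
    then show ?thesis using n(1) by (intro exI[of _ "(n, map k [0..<N], map l [0..<N])"]) simp
  qed
  then obtain p where p: "\<And>g. g \<in> b (fst (p g))" "\<And>g. good (p g)" by metis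
  have "P \<subseteq> (\<Union>g\<in>P. b (fst (p g)))" using p(1) by blast
  then obtain D where D: "finite D" "P \<subseteq> (\<Union>g\<in>D. b (fst (p g)))"
    using compactE_image[OF P, of P "\<lambda>g. b (fst (p g))"] b_open by metis
  obtain c where c: "set c = p ` D" using finite_list[of "p ` D"] D(1) by auto
  have PU: "P \<subseteq> (\<Union>q\<in>set c. b (fst q))" using D(2) by (simp add: c)
  have "\<forall>q\<in>set c. good q" using p(2) by (auto simp: c)
  then have "\<forall>(l, ks, ls)\<in>set c. \<forall>g\<in>b l. \<forall>i<N. sdist M (img T g (A i)) (A (ks ! i)) < \<delta> \<and>
      sdist M (img T (- g) (A i)) (A (ls ! i)) < \<delta>"
    by (force simp: good_def)
  moreover have "K i \<subseteq> (\<Union>q\<in>set c. b (fst q))" if "i \<in> I" "i < N" for i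
  proof -
    have "K i \<subseteq> P" using that by (auto simp: P_def)
    then show ?thesis using PU by (rule order_trans)
  qed
  moreover have "\<bar>measure M (img T g (A i) \<inter> A j) - measure M (A i) * measure M (A j)\<bar> < \<delta>"
    if "g \<in> \<Gamma> - (\<Union>q\<in>set c. b (fst q))" "i < N" "j < N" for g i j
  proof (rule Q(2))
    have "Q i j \<subseteq> P" using that by (auto simp: P_def)
    then show "g \<in> \<Gamma> - Q i j" using that(1) PU by blast
  qed
  ultimately have "coded b N T c" unfolding coded_def \<delta>_def[symmetric] by simp
  then show ?thesis ..
qed

text \<open>On U the images under both actions are near the same sets of the family; on \<Gamma>
  outside U both correlations are near the same product of measures. The code alone fixes U, so this
  division is common to the two actions.\<close>

lemma coded_close:
  assumes T: "alg_action M T" and S: "alg_action M S" and cT: "coded b N T c" and cS: "coded b N S c"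
  shows "m T S \<le> 48 * (1/2) ^ N"
proof -
  define \<delta> :: real where "\<delta> = (1/2) ^ N"
  have \<delta>: "\<delta> > 0" by (simp add: \<delta>_def)
  define U where "U = (\<Union>p\<in>set c. b (fst p))"
  have near: "sdist M (img T g (A i)) (img S g (A i)) \<le> 2 * \<delta> \<and>
      sdist M (img T (- g) (A i)) (img S (- g) (A i)) \<le> 2 * \<delta>" if g: "g \<in> U" and i: "i < N" for g i
  proof -
    obtain l ks ls where c: "(l, ks, ls) \<in> set c" "g \<in> b l" using g unfolding U_def by auto
    have *: "sdist M (img R g (A i)) (A (ks ! i)) < \<delta> \<and> sdist M (img R (- g) (A i)) (A (ls ! i)) < \<delta>"
      if "coded b N R c" for R
      using that c i unfolding coded_def \<delta>_def by blast
    have tri: "sdist M (img T h (A i)) (img S h (A i)) \<le> sdist M (img T h (A i)) (A q) + sdist M (img S h (A i)) (A q)" for h q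
      unfolding sdist_commute[of M "img S h (A i)" "A q"]
      by (intro sdist_triangle action_img_sets[OF T] action_img_sets[OF S] sets_A)
    show ?thesis
      using *[OF cT] *[OF cS] tri[of g "ks ! i"] tri[of "- g" "ls ! i"] by linarith
  qed
  have d_U: "d T S g \<le> 12 * \<delta>" if g: "g \<in> U" for g
  proof -
    have "d T S g \<le> 2 * (4 * \<delta>) + 2 * 2 * (1/2) ^ N"
      unfolding d_eq_img[OF T S]
    proof (rule dyadic_sum_small[OF d_terms])
      show "sdist M (img T g (A i)) (img S g (A i)) + sdist M (img T (- g) (A i)) (img S (- g) (A i)) \<le> 4 * \<delta>"
        if "i < N" for i using near[OF g that] by linarith
    qed (use \<delta> in simp)
    then show ?thesis by (simp add: \<delta>_def)
  qed
  have corr: "corr_diff T S g i j \<le> 2 * \<delta>" if g: "g \<in> \<Gamma>" and i: "i < N" and j: "j < N" for g i j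
  proof (cases "g \<in> U")
    case True
    have "corr_diff T S g i j \<le> sdist M (img T g (A i)) (img S g (A i))"
      unfolding corr_diff_def
      by (rule measure_Int_diff_le_sdist(1)[OF action_img_sets[OF T sets_A] action_img_sets[OF S sets_A] sets_A])
    then show ?thesis using near[OF True i] by linarith
  next
    case False
    then have *: "\<bar>measure M (img R g (A i) \<inter> A j) - measure M (A i) * measure M (A j)\<bar> < \<delta>"
      if "coded b N R c" for R
      using that g i j unfolding coded_def U_def \<delta>_def by blast
    show ?thesis using *[OF cT] *[OF cS] unfolding corr_diff_def by linarith
  qed
  have a_\<Gamma>: "a T S g \<le> 16 * \<delta>" if g: "g \<in> \<Gamma>" for g
  proof -
    have inner: "dyadic_sum (corr_diff T S g i) \<le> 6 * \<delta>" if "i < N" for i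
    proof -
      have "dyadic_sum (corr_diff T S g i) \<le> 2 * (2 * \<delta>) + 2 * 1 * (1/2) ^ N"
        by (rule dyadic_sum_small[OF corr_diff_nonneg corr_diff_le]) (use corr[OF g that] \<delta> in auto)
      then show ?thesis by (simp add: \<delta>_def)
    qed
    have "a T S g \<le> 2 * (6 * \<delta>) + 2 * 2 * (1/2) ^ N"
      unfolding a_eq by (rule dyadic_sum_small[OF corr_sum_nonneg corr_sum_le]) (use inner \<delta> in auto)
    then show ?thesis by (simp add: \<delta>_def)
  qed
  have sup_small: "sup_d T S i \<le> 12 * \<delta>" if i: "i < N" for i
  proof (rule sup_d_least)
    fix g assume "g \<in> K i" "i \<in> I"
    then have "g \<in> U" using cT i unfolding coded_def U_def by blast
    then show "d T S g \<le> 12 * \<delta>" by (rule d_U)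
  qed (use \<delta> in simp)
  \<comment> \<open>The constant is 48 = (2*12 + 2*4) + 16, where 12 = 2*4 + 4 bounds d on U, and 16
    = 2*6 + 4 with 6 = 2*2 + 2 bounds the double sum on \<Gamma>.\<close>
  have "dyadic_sum (sup_d T S) \<le> 2 * (12 * \<delta>) + 2 * 4 * (1/2) ^ N"
    by (rule dyadic_sum_small[OF sup_d_nonneg sup_d_le]) (use sup_small \<delta> in auto)
  moreover have "sup_a T S \<le> 16 * \<delta>" by (rule sup_a_least[OF a_\<Gamma>])
  ultimately show ?thesis by (simp add: m_eq \<delta>_def)
qed

lemma m_separable:
  "\<exists>D\<subseteq>mixing_actions M \<Gamma>. countable D \<and> (\<forall>T\<in>mixing_actions M \<Gamma>. \<forall>e>0. \<exists>S\<in>D. m T S < e)"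
proof -
  have "\<exists>C::nat \<Rightarrow> 'g set. (\<forall>n. compact (C n)) \<and> (\<Union>n. C n) = UNIV"
    by (rule sigma_compact_of_generated[OF add_cont minus_cont compact_K generating])
  then obtain C :: "nat \<Rightarrow> 'g set" where C: "\<And>n. compact (C n)" "(\<Union>n. C n) = UNIV" by auto
  have "\<exists>b::nat \<Rightarrow> 'g set. (\<forall>n. open (b n)) \<and>
      (\<forall>W x. open W \<longrightarrow> x \<in> W \<longrightarrow> (\<exists>n. x \<in> b n \<and> b n \<subseteq> W))"
    by (rule countable_base_of_sigma_compact[OF add_cont minus_cont C])
  then obtain b :: "nat \<Rightarrow> 'g set" where b: "\<And>n. open (b n)"
    "\<And>W x. open W \<Longrightarrow> x \<in> W \<Longrightarrow> \<exists>n. x \<in> b n \<and> b n \<subseteq> W" by metis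
  \<comment> \<open>A code need not come from any mixing action, so the dense set consists of one
    chosen action for each code that does. It is countable because a code is a finite list of
    naturals and lists of naturals.\<close>
  define rep where "rep q = (SOME S. S \<in> mixing_actions M \<Gamma> \<and> coded b (fst q) S (snd q))" for q
  define codes where "codes = {q. \<exists>S. S \<in> mixing_actions M \<Gamma> \<and> coded b (fst q) S (snd q)}"
  have rep: "rep q \<in> mixing_actions M \<Gamma> \<and> coded b (fst q) (rep q) (snd q)" if "q \<in> codes" for q
    using that unfolding rep_def codes_def mem_Collect_eq by (rule someI_ex)
  have "\<exists>S\<in>rep ` codes. m T S < e" if T: "T \<in> mixing_actions M \<Gamma>" and e: "e > 0" for T e
  proof -
    obtain N where N: "(1/2::real) ^ N < e / 48" using real_arch_pow_inv[of "e / 48" "1/2"] e by auto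
    obtain c where c: "coded b N T c" using coded_exists[of b, OF b T] by blast
    have q: "(N, c) \<in> codes" using T c by (auto simp: codes_def)
    have "m T (rep (N, c)) \<le> 48 * (1/2) ^ N"
      using rep[OF q] c by (intro coded_close[OF mixing_alg_action[OF T] mixing_alg_action]) auto
    also have "\<dots> < e" using N by simp
    finally show ?thesis using q by blast
  qed
  moreover have "rep ` codes \<subseteq> mixing_actions M \<Gamma>" using rep by blast
  moreover have "countable (rep ` codes)" by simp
  ultimately show ?thesis by blast
qed

end

theorem theorem1:
  fixes M :: "'a measure" and A :: "nat \<Rightarrow> 'a set"
    and I :: "nat set" and K :: "nat \<Rightarrow> 'g::{group_add,t2_space,first_countable_topology} set"
    and \<Gamma> :: "'g set"
  assumes "nonatomic_lebesgue_space M"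
    and "generating_dense_family M A"
    and "lc_topological_group TYPE('g)"
    and "\<forall>i\<in>I. compact (K i) \<and> interior (K i) \<noteq> {}"
    and "\<exists>S. S \<subseteq> (\<Union>i\<in>I. K i) \<and> generated_subgroup S = UNIV"
    and "unbounded_set \<Gamma>"
  shows
    "(\<forall>T\<in>mixing_actions M \<Gamma>. \<forall>S\<in>mixing_actions M \<Gamma>.
        metric_m M A I K \<Gamma> T S = metric_m M A I K \<Gamma> S T \<and>
        (metric_m M A I K \<Gamma> T S = 0 \<longleftrightarrow> action_equiv M T S) \<and>
        (\<forall>R\<in>mixing_actions M \<Gamma>.
           metric_m M A I K \<Gamma> T R \<le> metric_m M A I K \<Gamma> T S + metric_m M A I K \<Gamma> S R))
   \<and> (\<forall>X :: nat \<Rightarrow> 'g \<Rightarrow> 'a \<Rightarrow> 'a. (\<forall>n. X n \<in> mixing_actions M \<Gamma>) \<longrightarrow>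
        (\<forall>\<epsilon>>0. \<exists>N. \<forall>m\<ge>N. \<forall>n\<ge>N. metric_m M A I K \<Gamma> (X m) (X n) < \<epsilon>) \<longrightarrow>
        (\<exists>T\<in>mixing_actions M \<Gamma>. (\<lambda>n. metric_m M A I K \<Gamma> (X n) T) \<longlonglongrightarrow> 0))
   \<and> (\<exists>D \<subseteq> mixing_actions M \<Gamma>. countable D \<and>
        (\<forall>T\<in>mixing_actions M \<Gamma>. \<forall>\<epsilon>>0. \<exists>S\<in>D. metric_m M A I K \<Gamma> T S < \<epsilon>))"
proof -
  obtain \<phi> where phi: "lebesgue_coordinate M \<phi>" using lebesgue_coordinate_exists[OF assms(1)] by blast
  have prob: "prob_space M" using assms(1) by (simp add: nonatomic_lebesgue_space_def)
  interpret mixing_space M A I K \<Gamma> \<phi>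
  proof (rule mixing_space.intro[OF prob], unfold_locales)
    show "lebesgue_coordinate M \<phi>" by (rule phi)
    show "A i \<in> sets M" for i using assms(2) by (simp add: generating_dense_family_def)
    show "\<exists>i. sdist M B (A i) < e" if "B \<in> sets M" "0 < e" for B e
      using assms(2) that by (simp add: generating_dense_family_def sdist_def symdiff_def)
    show "continuous_on UNIV (\<lambda>p::'g \<times> 'g. fst p + snd p)" "continuous_on UNIV (uminus :: 'g \<Rightarrow> 'g)"
      using assms(3) by (simp_all add: lc_topological_group_def)
    show "compact (K i)" "interior (K i) \<noteq> {}" if "i \<in> I" for i using assms(4) that by auto
    show "H = UNIV" if H: "(\<Union>i\<in>I. K i) \<subseteq> H" "is_subgroup H" for H
    proof -
      obtain S where "S \<subseteq> (\<Union>i\<in>I. K i)" "generated_subgroup S = UNIV" using assms(5) by blast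
      then show ?thesis using generated_subgroup_UNIV_D[of S H] H by blast
    qed
    show "unbounded_set \<Gamma>" by (rule assms(6))
  qed
  show ?thesis
  proof (intro conjI ballI allI impI)
    fix T S assume TS: "T \<in> mixing_actions M \<Gamma>" "S \<in> mixing_actions M \<Gamma>"
    note alg = mixing_alg_action[OF TS(1)] mixing_alg_action[OF TS(2)]
    show "m T S = m S T" by (rule m_commute)
    show "m T S = 0 \<longleftrightarrow> action_equiv M T S"
      using m_eq_0_imp_equiv[OF alg] equiv_imp_m_eq_0[OF alg] by blast
    show "m T R \<le> m T S + m S R" if "R \<in> mixing_actions M \<Gamma>" for R
      by (rule m_triangle[OF alg mixing_alg_action[OF that]])
  next
    fix X :: "nat \<Rightarrow> 'g \<Rightarrow> 'a \<Rightarrow> 'a"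
    assume "\<forall>n. X n \<in> mixing_actions M \<Gamma>" "\<forall>\<epsilon>>0. \<exists>N. \<forall>p\<ge>N. \<forall>n\<ge>N. m (X p) (X n) < \<epsilon>"
    then show "\<exists>T\<in>mixing_actions M \<Gamma>. (\<lambda>n. m (X n) T) \<longlonglongrightarrow> 0"
      by (intro m_complete) auto
  qed (rule m_separable)
qed

end
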